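(* Let $M\ge 2$, $T>0$, $N\in\mathbb{N}$ with $N\ge 1$, and let $\tau=T/N$ be the time-step size (arbitrary, no smallness is assumed). Let $(\alpha_k^n)$, $(\boldsymbol{u}_k^n)$, $(\hat{\mathbf{u}}_k^n)$, $(p^n)$, $k=1,\dots,M$, $n=0,\dots,N$, be a solution of the fractional-step scheme described in the context, with zero volumetric forces and homogeneous Dirichlet velocity conditions. Assume that there is a constant $\alpha_{\min}>0$ such that $\alpha_k^n\ge\alpha_{\min}$ a.e. in $\Omega$ for all $n=0,\dots,N$ and all $k=1,\dots,M$, and let $\rho_{\min}=\min_{k}\rho_k$. Then $$ \begin{aligned} &\sum_{k=1}^{M}\left(\rho_k\left\|\sqrt{\alpha_k^{N}}\,\hat{\mathbf{u}}_k^{N}\right\|^2 + \tau\mu_k\left\|\sqrt{\alpha_k^{N}}\,\nabla\boldsymbol{u}_k^{N}\right\|^2 + \frac{\tau^2}{\rho_k}\left\|\sqrt{\alpha_k^{N}}\,\nabla p^{N} \right\|^2 \right)\\ &+\tau\sum_{n=1}^{N}\sum_{k=1}^{M}\left[\mu_k\left\|\sqrt{\alpha_k^{n}}\,\nabla\boldsymbol{u}_k^{n}+\sqrt{\alpha_k^{n-1}}\,\nabla^{\top}\boldsymbol{u}_k^{n-1}\right\|^2 + \sum_{l=1}^{M}\left\|\sqrt{\tilde{\gamma}_{kl}^{n-1}}\,(\hat{\mathbf{u}}_k^{n-1}-\hat{\mathbf{u}}_l^{n-1})\right\|^2\right]\\ &\leq \left(\sum_{k=1}^M B_k\right)\exp\left\{4\left[\frac{D(M-1)}{\rho_{\min}\alpha_{\min}}\right]^2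 T\tau\right\}, \end{aligned} $$ where $$ B_k = \left\{1+\left[\frac{2D(M-1)\tau}{\rho_{\min}\alpha_{\min}}\right]^2\right\}\rho_k\left\|\sqrt{\alpha_k^{0}}\,\boldsymbol{u}_k^{0}\right\|^2 + \tau\mu_k\left\|\sqrt{\alpha_k^{0}}\,\nabla\boldsymbol{u}_k^{0}\right\|^2 + \frac{\tau^2}{\rho_k}\left\|\sqrt{\alpha_k^{0}}\,\nabla p^{0} \right\|^2 . $$
   Context: Setting. $\Omega\subset\mathbb{R}^d$ ($d=2$ or $3$) is a bounded domain with boundary regular enough for the divergence theorem and outward unit normal $\boldsymbol{n}$. $\langle\cdot,\cdot\rangle$ and $\|\cdot\|$ are the $L^2(\Omega)$ inner product and norm (for scalar, vector and, with the Frobenius product, tensor fields). $\nabla\boldsymbol{u}$ is the matrix with entries $(\nabla\boldsymbol{u})_{ij}=\partial_j u_i$, $\nabla^{\top}\boldsymbol{u}$ is its transpose, the divergence of a matrix field is taken row-wise, and $\boldsymbol{v}\cdot\nabla\boldsymbol{u}:=(\nabla\boldsymbol{u})\boldsymbol{v}$. $\partial_{\boldsymbol n}p=\boldsymbol{n}\cdot\nabla p$. Parameters. For each phase $k=1,\dots,M$: constant density $\rho_k>0$ and constant $\mu_k=\rho_k\nu_k>0$, where $\nu_k>0$ is the kinematic viscosity. At each time level $n$ there are drag coefficients $\gamma_{kl}^n\ge 0$ (functions on $\Omega$, which may depend on the discrete solution at level $n$), with $\gamma_{kk}^n=0$ and $\gamma_{kl}^n=\gamma_{lk}^n$. For a fixed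 finite constant $D>0$ set $\tilde\gamma_{kl}^n:=\min\{\gamma_{kl}^n,D\}$. Volume fractions. $\alpha_k^n$ are positive scalar fields on $\Omega$, produced by an arbitrary scheme; no equation linking $\alpha_k^{n+1}$ to the other quantities is assumed. Scheme. Start from initial data $\boldsymbol{u}_k^0$ (vector fields, vanishing on $\partial\Omega$) and $p^0$ (scalar field), with $\hat{\mathbf{u}}_k^0=\boldsymbol{u}_k^0$. For $n=0,\dots,N-1$: (i) For each $k$, the velocity $\boldsymbol{u}_k^{n+1}$ satisfies $\boldsymbol{u}_k^{n+1}|_{\partial\Omega}=\boldsymbol{0}$ and, in $\Omega$, $$ \begin{aligned} &\rho_k\Big[\tfrac{\alpha_k^{n+1}+\alpha_k^{n}}{2\tau}\boldsymbol{u}_k^{n+1}+\alpha_k^{n+1}\boldsymbol{u}_k^n\cdot\nabla\boldsymbol{u}_k^{n+1}+\tfrac12\big(\nabla\cdot(\alpha_k^{n+1}\boldsymbol{u}_k^n)\big)\boldsymbol{u}_k^{n+1}\Big]-\nabla\cdot(\mu_k\alpha_k^{n+1}\nabla\boldsymbol{u}_k^{n+1})\\ &=\rho_k\tfrac{\alpha_k^n}{\tau}\hat{\mathbf{u}}_k^n+\nabla\cdot\Big(\mu_k\sqrt{\alpha_k^{n+1}\alpha_k^n}\,\nabla^{\top}\boldsymbol{u}_k^n\Big)-\sqrt{\alpha_k^{n+1}\alpha_k^n}\,\nabla p^n-\sum_{l=1}^M\tilde\gamma_{kl}^n(\hat{\mathbf{u}}_k^n-\hat{\mathbf{u}}_l^n).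 \end{aligned} $$ (ii) The pressure $p^{n+1}$ satisfies, in $\Omega$, $$ \nabla\cdot\Big[\Big(\sum_{k=1}^M\rho_k^{-1}\alpha_k^{n+1}\Big)\nabla p^{n+1}\Big]=\nabla\cdot\Big[\Big(\sum_{k=1}^M\rho_k^{-1}\sqrt{\alpha_k^{n+1}\alpha_k^n}\Big)\nabla p^n\Big]+\frac1\tau\nabla\cdot\sum_{k=1}^M\alpha_k^{n+1}\boldsymbol{u}_k^{n+1}, $$ with, on $\partial\Omega$, $\big(\sum_{k}\rho_k^{-1}\alpha_k^{n+1}\big)\partial_{\boldsymbol n}p^{n+1}=\big(\sum_{k}\rho_k^{-1}\sqrt{\alpha_k^{n+1}\alpha_k^n}\big)\partial_{\boldsymbol n}p^n$. (iii) For each $k$, $$ \hat{\mathbf{u}}_k^{n+1}=\boldsymbol{u}_k^{n+1}+\frac{\tau}{\rho_k}\left(\sqrt{\frac{\alpha_k^n}{\alpha_k^{n+1}}}\,\nabla p^n-\nabla p^{n+1}\right). $$ Regularity convention. The problem is discrete in time only, and all functions involved are assumed sufficiently regular in space that the equations above make sense and all integrations by parts over $\Omega$ (against the scheme's own velocities and pressures) are valid. *)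

theory Defs
  imports "HOL-Analysis.Analysis"
begin

section \<open>Differential operators\<close>

text \<open>All derivatives are classical ones, taken at interior points.  The velocity gradient is the
  library's \<^term>\<open>jacobian u (at x)\<close>, whose entry in row \<open>i\<close>, column \<open>j\<close> is \<open>\<partial>\<^sub>j u\<^sub>i\<close>; its library
  norm is the Frobenius norm.\<close>

definition grad :: "(real^'d \<Rightarrow> real) \<Rightarrow> real^'d \<Rightarrow> real^'d" where
  "grad q x = (\<chi> j. frechet_derivative q (at x) (axis j 1))"

definition divergence :: "(real^'d \<Rightarrow> real^'d) \<Rightarrow> real^'d \<Rightarrow> real" where
  "divergence F x = trace (jacobian F (at x))"

definition row_divergence :: "(real^'d \<Rightarrow> real^'d^'d) \<Rightarrow> real^'d \<Rightarrow> real^'d" where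
  "row_divergence A x = (\<chi> i. divergence (\<lambda>y. A y $ i) x)"

section \<open>Domain, boundary values and function spaces\<close>

text \<open>Boundary value at \<open>x \<in> \<partial>\<Omega>\<close> of a field given inside \<open>\<Omega>\<close>: its limit from inside.\<close>

definition has_boundary_value :: "(real^'d) set \<Rightarrow> (real^'d \<Rightarrow> 'b::t2_space) \<Rightarrow> real^'d \<Rightarrow> bool" where
  "has_boundary_value \<Omega> f x \<longleftrightarrow> (\<exists>l. (f \<longlongrightarrow> l) (at x within \<Omega>))"

definition boundary_value :: "(real^'d) set \<Rightarrow> (real^'d \<Rightarrow> 'b::t2_space) \<Rightarrow> real^'d \<Rightarrow> 'b" where
  "boundary_value \<Omega> f x = Lim (at x within \<Omega>) f"

definition normal_derivative ::
    "(real^'d) set \<Rightarrow> (real^'d \<Rightarrow> real^'d) \<Rightarrow> (real^'d \<Rightarrow> real) \<Rightarrow> real^'d \<Rightarrow> real" where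
  "normal_derivative \<Omega> nrm q x = nrm x \<bullet> boundary_value \<Omega> (grad q) x"

text \<open>A bounded domain \<open>\<Omega>\<close> with surface measure \<open>\<sigma>\<close> on its boundary and outward unit normal \<open>nrm\<close>
  for which the divergence theorem holds.  The sign and normalisation in the last clause make \<open>nrm\<close>
  the outward normal and \<open>\<sigma>\<close> the surface measure: since \<open>nrm\<close> has length one, that clause says that
  \<open>-nrm \<sigma>\<close> is the distributional gradient of the indicator function of \<open>\<Omega>\<close>, so it determines \<open>\<sigma>\<close>, and
  \<open>nrm\<close> up to a \<open>\<sigma>\<close>-null set.\<close>

definition gauss_domain ::
    "(real^'d) set \<Rightarrow> (real^'d) measure \<Rightarrow> (real^'d \<Rightarrow> real^'d) \<Rightarrow> bool" where
  "gauss_domain \<Omega> \<sigma> nrm \<longleftrightarrow>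
     open \<Omega> \<and> connected \<Omega> \<and> \<Omega> \<noteq> {} \<and> bounded \<Omega> \<and>
     sets \<sigma> = sets borel \<and> finite_measure \<sigma> \<and> (AE x in \<sigma>. x \<in> frontier \<Omega>) \<and>
     nrm \<in> borel_measurable borel \<and> (AE x in \<sigma>. norm (nrm x) = 1) \<and>
     (\<forall>F :: real^'d \<Rightarrow> real^'d.
        (\<forall>x. F differentiable (at x)) \<and> continuous_on UNIV (\<lambda>x. jacobian F (at x)) \<longrightarrow>
        (LINT x|lebesgue_on \<Omega>. divergence F x) = (LINT x|\<sigma>. F x \<bullet> nrm x))"

definition L2norm :: "(real^'d) set \<Rightarrow> (real^'d \<Rightarrow> 'b::real_normed_vector) \<Rightarrow> real" where
  "L2norm \<Omega> f = sqrt (LINT x|lebesgue_on \<Omega>. (norm (f x))\<^sup>2)"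

definition square_integrable :: "(real^'d) set \<Rightarrow> (real^'d \<Rightarrow> 'b::real_normed_vector) \<Rightarrow> bool" where
  "square_integrable \<Omega> f \<longleftrightarrow>
     f \<in> borel_measurable (lebesgue_on \<Omega>) \<and> integrable (lebesgue_on \<Omega>) (\<lambda>x. (norm (f x))\<^sup>2)"

section \<open>Integration by parts\<close>

text \<open>The formula \<open>\<integral>\<^sub>\<Omega> q (\<nabla> \<cdot> F) = \<integral>\<^sub>\<partial>\<^sub>\<Omega> q (F \<cdot> n) - \<integral>\<^sub>\<Omega> F \<cdot> \<nabla>q\<close> is meaningful and valid.\<close>

definition int_by_parts ::
    "(real^'d) set \<Rightarrow> (real^'d) measure \<Rightarrow> (real^'d \<Rightarrow> real^'d) \<Rightarrow>
     (real^'d \<Rightarrow> real^'d) \<Rightarrow> (real^'d \<Rightarrow> real) \<Rightarrow> bool" where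
  "int_by_parts \<Omega> \<sigma> nrm F q \<longleftrightarrow>
     (\<forall>x\<in>\<Omega>. F differentiable (at x)) \<and> (\<forall>x\<in>\<Omega>. q differentiable (at x)) \<and>
     (AE x in \<sigma>. has_boundary_value \<Omega> F x) \<and> (AE x in \<sigma>. has_boundary_value \<Omega> q x) \<and>
     integrable (lebesgue_on \<Omega>) (\<lambda>x. q x * divergence F x) \<and>
     integrable (lebesgue_on \<Omega>) (\<lambda>x. F x \<bullet> grad q x) \<and>
     integrable \<sigma> (\<lambda>x. boundary_value \<Omega> q x * (boundary_value \<Omega> F x \<bullet> nrm x)) \<and>
     (LINT x|lebesgue_on \<Omega>. q x * divergence F x) =
       (LINT x|\<sigma>. boundary_value \<Omega> q x * (boundary_value \<Omega> F x \<bullet> nrm x))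
       - (LINT x|lebesgue_on \<Omega>. F x \<bullet> grad q x)"

text \<open>For continuously differentiable fields the formula follows from the divergence theorem.\<close>

lemma int_by_parts_C1:
  fixes F :: "real^'d \<Rightarrow> real^'d" and q :: "real^'d \<Rightarrow> real"
  assumes dom: "gauss_domain \<Omega> \<sigma> nrm"
    and F: "\<And>x. F differentiable (at x)" "continuous_on UNIV (\<lambda>x. jacobian F (at x))"
    and q: "\<And>x. q differentiable (at x)" "continuous_on UNIV (grad q)"
  shows "int_by_parts \<Omega> \<sigma> nrm F q"
proof -
  have op: "open \<Omega>" and bd: "bounded \<Omega>" and fin: "finite_measure \<sigma>" and sets: "sets \<sigma> = sets borel"
    and fr: "AE x in \<sigma>. x \<in> frontier \<Omega>" and nm: "nrm \<in> borel_measurable borel" and n1: "AE x in \<sigma>. norm (nrm x) = 1"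
    and gg: "\<And>F :: real^'d \<Rightarrow> real^'d. (\<And>x. F differentiable (at x)) \<Longrightarrow> continuous_on UNIV (\<lambda>x. jacobian F (at x)) \<Longrightarrow>
        (LINT x|lebesgue_on \<Omega>. divergence F x) = (LINT x|\<sigma>. F x \<bullet> nrm x)"
    using dom by (auto simp: gauss_domain_def)
  let ?G = "\<lambda>x. q x *\<^sub>R F x"
  have cF: "continuous_on UNIV F" using F(1) by (simp add: continuous_on_eq_continuous_at differentiable_imp_continuous_within)
  have cq: "continuous_on UNIV q" using q(1) by (simp add: continuous_on_eq_continuous_at differentiable_imp_continuous_within)
  have dG: "?G differentiable (at x)" for x
    using F(1) q(1) by (intro differentiable_scaleR) auto
  have fd: "frechet_derivative ?G (at x) h = q x *\<^sub>R frechet_derivative F (at x) h + frechet_derivative q (at x) h *\<^sub>R F x" for x h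
  proof -
    have "(?G has_derivative (\<lambda>h. q x *\<^sub>R frechet_derivative F (at x) h + frechet_derivative q (at x) h *\<^sub>R F x)) (at x)"
      using F(1)[of x] q(1)[of x] by (intro has_derivative_scaleR) (auto simp: frechet_derivative_works[symmetric])
    from fun_cong[OF frechet_derivative_at[OF this]] show ?thesis by simp
  qed
  have jG: "jacobian ?G (at x) = (\<chi> i j. q x * jacobian F (at x) $ i $ j + grad q x $ j * F x $ i)" for x
    by (simp add: vec_eq_iff jacobian_def matrix_def grad_def fd)
  have cjG: "continuous_on UNIV (\<lambda>x. jacobian ?G (at x))"
    unfolding jG by (intro continuous_intros cq cF F q)
  have dvG: "divergence ?G x = q x * divergence F x + F x \<bullet> grad q x" for x
    by (simp add: divergence_def trace_def jG sum.distrib sum_distrib_left inner_vec_def mult.commute)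
  have int: "integrable (lebesgue_on \<Omega>) f" if c: "continuous_on UNIV f" for f :: "real^'d \<Rightarrow> real"
  proof -
    obtain a b where ab: "\<Omega> \<subseteq> cbox a b" using bd bounded_subset_cbox_symmetric by metis
    have "f absolutely_integrable_on cbox a b"
      by (intro absolutely_integrable_continuous continuous_on_subset[OF c]) simp
    then have "f absolutely_integrable_on \<Omega>"
      by (rule set_integrable_subset) (use op ab in auto)
    then show ?thesis using op by (simp add: set_integrable_def integrable_restrict_space)
  qed
  interpret finite_measure \<sigma> by (rule fin)
  have bv: "x \<in> closure \<Omega> \<Longrightarrow> has_boundary_value \<Omega> f x" "x \<in> closure \<Omega> \<Longrightarrow> boundary_value \<Omega> f x = f x"
    if c: "continuous_on UNIV f" for f :: "real^'d \<Rightarrow> 'b::t2_space" and x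
  proof -
    have t: "(f \<longlongrightarrow> f x) (at x within \<Omega>)"
      using c by (meson UNIV_I continuous_on_def subset_UNIV tendsto_within_subset)
    then show "has_boundary_value \<Omega> f x" unfolding has_boundary_value_def by blast
    assume "x \<in> closure \<Omega>"
    then have "at x within \<Omega> \<noteq> bot"
      using op interior_limit_point[of x \<Omega>] by (auto simp: closure_def trivial_limit_within interior_open)
    with t show "boundary_value \<Omega> f x = f x" by (simp add: boundary_value_def tendsto_Lim)
  qed
  have bx: "boundary_value \<Omega> f x = (THE l. True)" if "x \<notin> closure \<Omega>" for f :: "real^'d \<Rightarrow> 'b::t2_space" and x
  proof -
    have "at x within \<Omega> = bot" using that not_in_closure_trivial_limitI by blast
    then show ?thesis by (simp add: boundary_value_def Topological_Spaces.Lim_def)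
  qed
  have AEb: "AE x in \<sigma>. boundary_value \<Omega> q x * (boundary_value \<Omega> F x \<bullet> nrm x) = ?G x \<bullet> nrm x"
    using fr by eventually_elim (simp add: bv cq cF frontier_def)
  have mG: "(\<lambda>x. ?G x \<bullet> nrm x) \<in> borel_measurable \<sigma>"
    unfolding measurable_cong_sets[OF sets refl]
    by (intro borel_measurable_inner nm borel_measurable_continuous_onI continuous_on_scaleR cq cF)
  have "compact (frontier \<Omega>)" using bd by (simp add: compact_frontier_bounded)
  then have "compact (?G ` frontier \<Omega>)"
    by (intro compact_continuous_image continuous_on_subset[OF continuous_on_scaleR[OF cq cF]]) auto
  then obtain K where K: "\<And>x. x \<in> frontier \<Omega> \<Longrightarrow> norm (?G x) \<le> K"
    using compact_imp_bounded bounded_iff by (metis (mono_tags, lifting) imageI)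
  have iG: "integrable \<sigma> (\<lambda>x. ?G x \<bullet> nrm x)"
  proof (rule integrable_const_bound[OF _ mG])
    show "AE x in \<sigma>. norm (?G x \<bullet> nrm x) \<le> K"
      using fr n1
    proof eventually_elim
      case (elim x)
      have "norm (?G x \<bullet> nrm x) \<le> norm (?G x) * norm (nrm x)" using Cauchy_Schwarz_ineq2[of "?G x" "nrm x"] by simp
      then show ?case using K[of x] elim by simp
    qed
  qed
  let ?H = "\<lambda>x. boundary_value \<Omega> q x * (boundary_value \<Omega> F x \<bullet> nrm x)"
  let ?c = "THE l::real. True" and ?d = "THE l::real^'d. True"
  have H: "?H = (\<lambda>x. if x \<in> closure \<Omega> then ?G x \<bullet> nrm x else ?c * (?d \<bullet> nrm x))"
    by (rule ext) (auto simp: bv cq cF bx)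
  have "(\<lambda>x. if x \<in> closure \<Omega> then ?G x \<bullet> nrm x else ?c * (?d \<bullet> nrm x)) \<in> borel_measurable \<sigma>"
  proof (rule measurable_If_set[OF mG])
    show "(\<lambda>x. ?c * (?d \<bullet> nrm x)) \<in> borel_measurable \<sigma>"
      unfolding measurable_cong_sets[OF sets refl] using nm by measurable
    show "closure \<Omega> \<inter> space \<sigma> \<in> sets \<sigma>"
      using sets_eq_imp_space_eq[OF sets] by (simp add: sets)
  qed
  then have mH: "?H \<in> borel_measurable \<sigma>" by (simp only: H)
  have ab: "integrable \<sigma> ?H" "integral\<^sup>L \<sigma> ?H = (LINT x|\<sigma>. ?G x \<bullet> nrm x)"
    using integrable_cong_AE[OF mH mG AEb] integral_cong_AE[OF mH mG AEb] iG by auto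
  have abv: "AE x in \<sigma>. has_boundary_value \<Omega> F x" "AE x in \<sigma>. has_boundary_value \<Omega> q x"
    using fr by (eventually_elim, simp add: bv cF cq frontier_def)+
  have i1: "integrable (lebesgue_on \<Omega>) (\<lambda>x. q x * divergence F x)"
    unfolding divergence_def trace_def by (intro int continuous_intros cq F)
  have i2: "integrable (lebesgue_on \<Omega>) (\<lambda>x. F x \<bullet> grad q x)"
    by (intro int continuous_intros cF q)
  have "(LINT x|lebesgue_on \<Omega>. divergence ?G x) = (LINT x|\<sigma>. ?G x \<bullet> nrm x)"
    by (rule gg[OF dG cjG])
  then have eq: "(LINT x|lebesgue_on \<Omega>. q x * divergence F x) + (LINT x|lebesgue_on \<Omega>. F x \<bullet> grad q x)
      = integral\<^sup>L \<sigma> ?H"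
    unfolding ab(2) dvG Bochner_Integration.integral_add[OF i1 i2] .
  show ?thesis unfolding int_by_parts_def
    using i1 i2 ab(1) abv eq F(1) q(1) by auto
qed

definition row_int_by_parts ::
    "(real^'d) set \<Rightarrow> (real^'d) measure \<Rightarrow> (real^'d \<Rightarrow> real^'d) \<Rightarrow>
     (real^'d \<Rightarrow> real^'d^'d) \<Rightarrow> (real^'d \<Rightarrow> real^'d) \<Rightarrow> bool" where
  "row_int_by_parts \<Omega> \<sigma> nrm A v \<longleftrightarrow> (\<forall>i. int_by_parts \<Omega> \<sigma> nrm (\<lambda>x. A x $ i) (\<lambda>x. v x $ i))"

section \<open>The fractional-step scheme\<close>

text \<open>A phase-\<open>k\<close> quantity at time level \<open>n\<close> is written \<open>\<alpha> k n\<close>, \<open>u k n\<close>, \<open>uh k n\<close> (the latter for the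
  hatted velocity); phases are \<open>1..M\<close>, time levels \<open>0..N\<close>.\<close>

definition truncated_drag :: "real \<Rightarrow> (real^'d \<Rightarrow> real) \<Rightarrow> real^'d \<Rightarrow> real" where
  "truncated_drag D g x = min (g x) D"

definition admissible_drag ::
    "(real^'d) set \<Rightarrow> nat \<Rightarrow> nat \<Rightarrow> (nat \<Rightarrow> nat \<Rightarrow> nat \<Rightarrow> real^'d \<Rightarrow> real) \<Rightarrow> bool" where
  "admissible_drag \<Omega> M N \<gamma> \<longleftrightarrow>
     (\<forall>n<N. \<forall>k\<in>{1..M}. \<forall>l\<in>{1..M}.
        \<gamma> k l n \<in> borel_measurable (lebesgue_on \<Omega>) \<and>
        (\<forall>x\<in>\<Omega>. \<gamma> k l n x \<ge> 0 \<and> \<gamma> k k n x = 0 \<and> \<gamma> k l n x = \<gamma> l k n x))"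

definition momentum_equation ::
    "(real^'d) set \<Rightarrow> nat \<Rightarrow> real \<Rightarrow> (nat \<Rightarrow> real) \<Rightarrow> (nat \<Rightarrow> real) \<Rightarrow> real \<Rightarrow>
     (nat \<Rightarrow> nat \<Rightarrow> nat \<Rightarrow> real^'d \<Rightarrow> real) \<Rightarrow>
     (nat \<Rightarrow> nat \<Rightarrow> real^'d \<Rightarrow> real) \<Rightarrow> (nat \<Rightarrow> nat \<Rightarrow> real^'d \<Rightarrow> real^'d) \<Rightarrow>
     (nat \<Rightarrow> nat \<Rightarrow> real^'d \<Rightarrow> real^'d) \<Rightarrow> (nat \<Rightarrow> real^'d \<Rightarrow> real) \<Rightarrow> nat \<Rightarrow> nat \<Rightarrow> bool" where
  "momentum_equation \<Omega> M \<tau> \<rho> \<mu> D \<gamma> \<alpha> u uh p k n \<longleftrightarrow>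
     (\<forall>x\<in>\<Omega>.
        \<rho> k *\<^sub>R (((\<alpha> k (Suc n) x + \<alpha> k n x) / (2 * \<tau>)) *\<^sub>R u k (Suc n) x
                + \<alpha> k (Suc n) x *\<^sub>R (jacobian (u k (Suc n)) (at x) *v u k n x)
                + ((1/2) * divergence (\<lambda>y. \<alpha> k (Suc n) y *\<^sub>R u k n y) x) *\<^sub>R u k (Suc n) x)
        - row_divergence (\<lambda>y. (\<mu> k * \<alpha> k (Suc n) y) *\<^sub>R jacobian (u k (Suc n)) (at y)) x
      = (\<rho> k * \<alpha> k n x / \<tau>) *\<^sub>R uh k n x
        + row_divergence (\<lambda>y. (\<mu> k * sqrt (\<alpha> k (Suc n) y * \<alpha> k n y))
                                *\<^sub>R transpose (jacobian (u k n) (at y))) x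
        - sqrt (\<alpha> k (Suc n) x * \<alpha> k n x) *\<^sub>R grad (p n) x
        - (\<Sum>l=1..M. truncated_drag D (\<gamma> k l n) x *\<^sub>R (uh k n x - uh l n x)))"

definition pressure_equation ::
    "(real^'d) set \<Rightarrow> (real^'d) measure \<Rightarrow> (real^'d \<Rightarrow> real^'d) \<Rightarrow> nat \<Rightarrow> real \<Rightarrow> (nat \<Rightarrow> real) \<Rightarrow>
     (nat \<Rightarrow> nat \<Rightarrow> real^'d \<Rightarrow> real) \<Rightarrow> (nat \<Rightarrow> nat \<Rightarrow> real^'d \<Rightarrow> real^'d) \<Rightarrow>
     (nat \<Rightarrow> real^'d \<Rightarrow> real) \<Rightarrow> nat \<Rightarrow> bool" where
  "pressure_equation \<Omega> \<sigma> nrm M \<tau> \<rho> \<alpha> u p n \<longleftrightarrow>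
     (\<forall>x\<in>\<Omega>.
        divergence (\<lambda>y. (\<Sum>k=1..M. \<alpha> k (Suc n) y / \<rho> k) *\<^sub>R grad (p (Suc n)) y) x
      = divergence (\<lambda>y. (\<Sum>k=1..M. sqrt (\<alpha> k (Suc n) y * \<alpha> k n y) / \<rho> k) *\<^sub>R grad (p n) y) x
        + (1 / \<tau>) * divergence (\<lambda>y. \<Sum>k=1..M. \<alpha> k (Suc n) y *\<^sub>R u k (Suc n) y) x) \<and>
     (AE x in \<sigma>.
        (\<Sum>k=1..M. \<alpha> k (Suc n) x / \<rho> k) * normal_derivative \<Omega> nrm (p (Suc n)) x
      = (\<Sum>k=1..M. sqrt (\<alpha> k (Suc n) x * \<alpha> k n x) / \<rho> k) * normal_derivative \<Omega> nrm (p n) x)"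

definition velocity_correction ::
    "(real^'d) set \<Rightarrow> real \<Rightarrow> (nat \<Rightarrow> real) \<Rightarrow>
     (nat \<Rightarrow> nat \<Rightarrow> real^'d \<Rightarrow> real) \<Rightarrow> (nat \<Rightarrow> nat \<Rightarrow> real^'d \<Rightarrow> real^'d) \<Rightarrow>
     (nat \<Rightarrow> nat \<Rightarrow> real^'d \<Rightarrow> real^'d) \<Rightarrow> (nat \<Rightarrow> real^'d \<Rightarrow> real) \<Rightarrow> nat \<Rightarrow> nat \<Rightarrow> bool" where
  "velocity_correction \<Omega> \<tau> \<rho> \<alpha> u uh p k n \<longleftrightarrow>
     (\<forall>x\<in>\<Omega>. uh k (Suc n) x =
        u k (Suc n) x
        + (\<tau> / \<rho> k) *\<^sub>R (sqrt (\<alpha> k n x / \<alpha> k (Suc n) x) *\<^sub>R grad (p n) x - grad (p (Suc n)) x))"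

definition scheme_solution ::
    "(real^'d) set \<Rightarrow> (real^'d) measure \<Rightarrow> (real^'d \<Rightarrow> real^'d) \<Rightarrow> nat \<Rightarrow> nat \<Rightarrow> real \<Rightarrow>
     (nat \<Rightarrow> real) \<Rightarrow> (nat \<Rightarrow> real) \<Rightarrow> real \<Rightarrow> (nat \<Rightarrow> nat \<Rightarrow> nat \<Rightarrow> real^'d \<Rightarrow> real) \<Rightarrow>
     (nat \<Rightarrow> nat \<Rightarrow> real^'d \<Rightarrow> real) \<Rightarrow> (nat \<Rightarrow> nat \<Rightarrow> real^'d \<Rightarrow> real^'d) \<Rightarrow>
     (nat \<Rightarrow> nat \<Rightarrow> real^'d \<Rightarrow> real^'d) \<Rightarrow> (nat \<Rightarrow> real^'d \<Rightarrow> real) \<Rightarrow> bool" where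
  "scheme_solution \<Omega> \<sigma> nrm M N \<tau> \<rho> \<mu> D \<gamma> \<alpha> u uh p \<longleftrightarrow>
     (\<forall>k\<in>{1..M}. \<forall>n\<le>N. \<forall>x\<in>\<Omega>. \<alpha> k n x > 0) \<and>
     (\<forall>k\<in>{1..M}. \<forall>n\<le>N. \<forall>x\<in>frontier \<Omega>. u k n x = 0) \<and>
     (\<forall>k\<in>{1..M}. \<forall>x\<in>\<Omega>. uh k 0 x = u k 0 x) \<and>
     (\<forall>n<N. (\<forall>k\<in>{1..M}. momentum_equation \<Omega> M \<tau> \<rho> \<mu> D \<gamma> \<alpha> u uh p k n) \<and>
            pressure_equation \<Omega> \<sigma> nrm M \<tau> \<rho> \<alpha> u p n \<and>
            (\<forall>k\<in>{1..M}. velocity_correction \<Omega> \<tau> \<rho> \<alpha> u uh p k n))"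

section \<open>The regularity convention\<close>

text \<open>First, the classical derivatives in the equations exist, boundary values are attained, and
  velocity and pressure gradients are square integrable.  Second, every flux under a divergence in
  the scheme can be integrated by parts: those of the momentum equation against the new velocity,
  those of the pressure equation against the new pressure.  The convective flux enters as the
  tensor with rows \<open>\<alpha>\<^sub>k\<^sup>n\<^sup>+\<^sup>1 u\<^sub>k\<^sub>,\<^sub>i\<^sup>n\<^sup>+\<^sup>1 u\<^sub>k\<^sup>n\<close>.\<close>

definition scheme_regular ::
    "(real^'d) set \<Rightarrow> (real^'d) measure \<Rightarrow> (real^'d \<Rightarrow> real^'d) \<Rightarrow> nat \<Rightarrow> nat \<Rightarrow>
     (nat \<Rightarrow> real) \<Rightarrow> (nat \<Rightarrow> real) \<Rightarrow>
     (nat \<Rightarrow> nat \<Rightarrow> real^'d \<Rightarrow> real) \<Rightarrow> (nat \<Rightarrow> nat \<Rightarrow> real^'d \<Rightarrow> real^'d) \<Rightarrow>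
     (nat \<Rightarrow> real^'d \<Rightarrow> real) \<Rightarrow> bool" where
  "scheme_regular \<Omega> \<sigma> nrm M N \<rho> \<mu> \<alpha> u p \<longleftrightarrow>
     (\<forall>k\<in>{1..M}. \<forall>n\<le>N.
        continuous_on (closure \<Omega>) (\<alpha> k n) \<and> (\<forall>x\<in>\<Omega>. \<alpha> k n differentiable (at x)) \<and>
        continuous_on (closure \<Omega>) (u k n) \<and> (\<forall>x\<in>\<Omega>. u k n differentiable (at x)) \<and>
        (\<forall>x\<in>\<Omega>. (\<lambda>y. jacobian (u k n) (at y)) differentiable (at x)) \<and>
        square_integrable \<Omega> (\<lambda>x. jacobian (u k n) (at x))) \<and>
     (\<forall>n\<le>N.
        continuous_on (closure \<Omega>) (p n) \<and> (\<forall>x\<in>\<Omega>. p n differentiable (at x)) \<and>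
        (\<forall>x\<in>\<Omega>. grad (p n) differentiable (at x)) \<and>
        square_integrable \<Omega> (grad (p n)) \<and> (AE x in \<sigma>. has_boundary_value \<Omega> (grad (p n)) x)) \<and>
     (\<forall>n<N. \<forall>k\<in>{1..M}.
        row_int_by_parts \<Omega> \<sigma> nrm
          (\<lambda>x. \<chi> i. (\<alpha> k (Suc n) x * u k (Suc n) x $ i) *\<^sub>R u k n x) (u k (Suc n)) \<and>
        row_int_by_parts \<Omega> \<sigma> nrm
          (\<lambda>x. (\<mu> k * \<alpha> k (Suc n) x) *\<^sub>R jacobian (u k (Suc n)) (at x)) (u k (Suc n)) \<and>
        row_int_by_parts \<Omega> \<sigma> nrm
          (\<lambda>x. (\<mu> k * sqrt (\<alpha> k (Suc n) x * \<alpha> k n x)) *\<^sub>R transpose (jacobian (u k n) (at x)))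
          (u k (Suc n))) \<and>
     (\<forall>n<N.
        int_by_parts \<Omega> \<sigma> nrm
          (\<lambda>x. (\<Sum>k=1..M. \<alpha> k (Suc n) x / \<rho> k) *\<^sub>R grad (p (Suc n)) x) (p (Suc n)) \<and>
        int_by_parts \<Omega> \<sigma> nrm
          (\<lambda>x. (\<Sum>k=1..M. sqrt (\<alpha> k (Suc n) x * \<alpha> k n x) / \<rho> k) *\<^sub>R grad (p n) x) (p (Suc n)) \<and>
        int_by_parts \<Omega> \<sigma> nrm
          (\<lambda>x. \<Sum>k=1..M. \<alpha> k (Suc n) x *\<^sub>R u k (Suc n) x) (p (Suc n)))"

end

theory Submission
  imports Defs
begin

text \<open>Testing the momentum equation with \<open>2 \<tau> u\<^sub>k\<^sup>n\<^sup>+\<^sup>1\<close> and squaring the velocity correction, written as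
  \<open>\<surd>\<alpha>\<^sup>n\<^sup>+\<^sup>1 (uh\<^sup>n\<^sup>+\<^sup>1 + \<tau>/\<rho> \<nabla>p\<^sup>n\<^sup>+\<^sup>1) = \<surd>\<alpha>\<^sup>n\<^sup>+\<^sup>1 u\<^sup>n\<^sup>+\<^sup>1 + \<tau>/\<rho> \<surd>\<alpha>\<^sup>n \<nabla>p\<^sup>n\<close>, gives a pointwise energy balance up to terms
  whose integrals vanish: the convective and viscous ones because velocities vanish on the boundary,
  and \<open>\<Sum>\<^sub>k \<alpha>\<^sub>k\<^sup>n\<^sup>+\<^sup>1 uh\<^sub>k\<^sup>n\<^sup>+\<^sup>1 \<bullet> \<nabla>p\<^sup>n\<^sup>+\<^sup>1\<close> by the pressure equation.
  The drag involves only the old hatted velocities, so besides its dissipation it leaves a product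
  with \<open>uh\<^sup>n - u\<^sup>n\<^sup>+\<^sup>1\<close>.  Young's inequality absorbs this into the numerical dissipation
  \<open>\<rho> \<alpha>\<^sup>n |uh\<^sup>n - u\<^sup>n\<^sup>+\<^sup>1|\<^sup>2\<close> at the price of \<open>O(\<tau>\<^sup>2)\<close> times the old kinetic energy, and the discrete
  Gronwall inequality concludes.\<close>

section \<open>Algebra of the drag force\<close>

text \<open>Exchanging \<open>k\<close> and \<open>l\<close> pairs every weighted term with its
  mirror image. By symmetry of the weights the pair adds up to \<open>c k l\<close> times
  \<open>(v k - v l) \<bullet> v k + (v l - v k) \<bullet> v l\<close>, which is the square of the
  difference. This turns the drag tested with the old hatted velocities into dissipation.\<close>

lemma drag_work:
  fixes c :: "'i \<Rightarrow> 'i \<Rightarrow> real" and v :: "'i \<Rightarrow> 'a::real_inner"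
  assumes "\<And>k l. k \<in> I \<Longrightarrow> l \<in> I \<Longrightarrow> c k l = c l k"
  shows "2 * (\<Sum>k\<in>I. (\<Sum>l\<in>I. c k l *\<^sub>R (v k - v l)) \<bullet> v k)
       = (\<Sum>k\<in>I. \<Sum>l\<in>I. c k l * (norm (v k - v l))\<^sup>2)"
proof -
  let ?S = "\<Sum>k\<in>I. \<Sum>l\<in>I. c k l * ((v k - v l) \<bullet> v k)"
  have "?S = (\<Sum>k\<in>I. \<Sum>l\<in>I. c l k * ((v l - v k) \<bullet> v l))"
    by (rule sum.swap)
  also have "\<dots> = (\<Sum>k\<in>I. \<Sum>l\<in>I. c k l * ((v l - v k) \<bullet> v l))"
    using assms by (intro sum.cong refl) simp
  finally have "2 * ?S = ?S + (\<Sum>k\<in>I. \<Sum>l\<in>I. c k l * ((v l - v k) \<bullet> v l))"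
    by simp
  also have "\<dots> = (\<Sum>k\<in>I. \<Sum>l\<in>I. c k l * (norm (v k - v l))\<^sup>2)"
    unfolding sum.distrib[symmetric]
    by (intro sum.cong refl) (simp add: power2_norm_eq_inner algebra_simps inner_commute)
  finally show ?thesis by (simp add: inner_sum_left)
qed

text \<open>Cauchy-Schwarz after splitting each weight into two factors \<open>sqrt (c l)\<close>.
  The total weight then appears only to the first power, so a bound on the degree can be
  inserted.\<close>

lemma norm_sum_scaleR_power2_le:
  fixes v :: "'i \<Rightarrow> 'a::real_inner"
  assumes c: "\<And>l. l \<in> I \<Longrightarrow> 0 \<le> c l"
  shows "(norm (\<Sum>l\<in>I. c l *\<^sub>R v l))\<^sup>2 \<le> (\<Sum>l\<in>I. c l) * (\<Sum>l\<in>I. c l * (norm (v l))\<^sup>2)"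
proof -
  have "norm (\<Sum>l\<in>I. c l *\<^sub>R v l) \<le> (\<Sum>l\<in>I. sqrt (c l) * (sqrt (c l) * norm (v l)))"
    using c by (intro sum_norm_le) (simp flip: mult.assoc)
  then have "(norm (\<Sum>l\<in>I. c l *\<^sub>R v l))\<^sup>2 \<le> (\<Sum>l\<in>I. sqrt (c l) * (sqrt (c l) * norm (v l)))\<^sup>2"
    by (rule power_mono) simp
  also have "\<dots> \<le> (\<Sum>l\<in>I. (sqrt (c l))\<^sup>2) * (\<Sum>l\<in>I. (sqrt (c l) * norm (v l))\<^sup>2)"
    by (rule Cauchy_Schwarz_ineq_sum)
  also have "\<dots> = (\<Sum>l\<in>I. c l) * (\<Sum>l\<in>I. c l * (norm (v l))\<^sup>2)"
    using c by (simp add: power_mult_distrib)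
  finally show ?thesis .
qed

text \<open>The drag force is a weighted graph Laplacian of degree at most \<open>D (card I - 1)\<close>, so its
  operator norm is at most twice that.\<close>

lemma drag_force_bound:
  fixes c :: "'i \<Rightarrow> 'i \<Rightarrow> real" and v :: "'i \<Rightarrow> 'a::real_inner"
  assumes fin: "finite I" and D: "0 \<le> D"
    and c: "\<And>k l. k \<in> I \<Longrightarrow> l \<in> I \<Longrightarrow> 0 \<le> c k l \<and> c k l \<le> D \<and> c k l = c l k \<and> c k k = 0"
  shows "(\<Sum>k\<in>I. (norm (\<Sum>l\<in>I. c k l *\<^sub>R (v k - v l)))\<^sup>2)
       \<le> 4 * (D * (real (card I) - 1))\<^sup>2 * (\<Sum>k\<in>I. (norm (v k))\<^sup>2)"
proof (cases "I = {}")
  case False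
  define \<Delta> where "\<Delta> = D * (real (card I) - 1)"
  have card: "1 \<le> card I" using False fin by (simp add: Suc_leI card_gt_0_iff)
  have \<Delta>0: "0 \<le> \<Delta>" using card D by (simp add: \<Delta>_def)
  have deg: "(\<Sum>l\<in>I. c k l) \<le> \<Delta>" if k: "k \<in> I" for k
  proof -
    \<comment> \<open>The vanishing diagonal weight accounts for \<open>card I - 1\<close> in place
      of \<open>card I\<close>.\<close>
    have "(\<Sum>l\<in>I. c k l) = (\<Sum>l\<in>I - {k}. c k l)"
      using fin k c by (simp add: sum.remove)
    also have "\<dots> \<le> real (card (I - {k})) * D"
      using c k by (intro sum_bounded_above) auto
    also have "\<dots> = \<Delta>"
      using k fin card by (simp add: \<Delta>_def of_nat_diff)
    finally show ?thesis .
  qed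
  have sq: "(norm (v k - v l))\<^sup>2 \<le> 2 * (norm (v k))\<^sup>2 + 2 * (norm (v l))\<^sup>2" for k l
    using zero_le_power2[of "norm (v k + v l)"]
    by (simp add: power2_norm_eq_inner algebra_simps inner_commute)
  have *: "(norm (\<Sum>l\<in>I. c k l *\<^sub>R (v k - v l)))\<^sup>2
      \<le> \<Delta> * (\<Sum>l\<in>I. c k l * (2 * (norm (v k))\<^sup>2 + 2 * (norm (v l))\<^sup>2))" if k: "k \<in> I" for k
  proof -
    have "(norm (\<Sum>l\<in>I. c k l *\<^sub>R (v k - v l)))\<^sup>2
        \<le> (\<Sum>l\<in>I. c k l) * (\<Sum>l\<in>I. c k l * (norm (v k - v l))\<^sup>2)"
      by (rule norm_sum_scaleR_power2_le) (use c k in auto)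
    also have "\<dots> \<le> \<Delta> * (\<Sum>l\<in>I. c k l * (2 * (norm (v k))\<^sup>2 + 2 * (norm (v l))\<^sup>2))"
      using c k by (intro mult_mono deg sum_mono mult_left_mono sq \<Delta>0 sum_nonneg) auto
    finally show ?thesis .
  qed
  \<comment> \<open>Symmetry moves the neighbours' squares back to their own vertices. Both halves
    of the estimate thus give the same degree-weighted sum, which doubles the factor 2 coming from
    \<open>sq\<close>.\<close>
  have sym: "(\<Sum>k\<in>I. \<Sum>l\<in>I. c k l * (norm (v l))\<^sup>2) = (\<Sum>k\<in>I. (\<Sum>l\<in>I. c k l) * (norm (v k))\<^sup>2)"
    unfolding sum_distrib_right by (subst sum.swap) (use c in \<open>auto intro!: sum.cong\<close>)
  have "(\<Sum>k\<in>I. (norm (\<Sum>l\<in>I. c k l *\<^sub>R (v k - v l)))\<^sup>2)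
      \<le> (\<Sum>k\<in>I. \<Delta> * (\<Sum>l\<in>I. c k l * (2 * (norm (v k))\<^sup>2 + 2 * (norm (v l))\<^sup>2)))"
    by (intro sum_mono *)
  also have "\<dots> = 2 * \<Delta> * ((\<Sum>k\<in>I. (\<Sum>l\<in>I. c k l) * (norm (v k))\<^sup>2)
      + (\<Sum>k\<in>I. \<Sum>l\<in>I. c k l * (norm (v l))\<^sup>2))"
    by (simp add: sum_distrib_left sum_distrib_right sum.distrib algebra_simps)
  also have "\<dots> = 4 * \<Delta> * (\<Sum>k\<in>I. (\<Sum>l\<in>I. c k l) * (norm (v k))\<^sup>2)"
    by (simp only: sym) simp
  also have "\<dots> \<le> 4 * \<Delta> * (\<Sum>k\<in>I. \<Delta> * (norm (v k))\<^sup>2)"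
    using \<Delta>0 by (intro mult_left_mono sum_mono mult_right_mono deg) auto
  also have "\<dots> = 4 * \<Delta>\<^sup>2 * (\<Sum>k\<in>I. (norm (v k))\<^sup>2)"
    by (simp add: sum_distrib_left power2_eq_square mult.assoc)
  finally show ?thesis by (simp add: \<Delta>_def)
qed simp

section \<open>Energy balance of one phase at one point\<close>

text \<open>\<open>C\<close> stands for the convective term, \<open>R\<^sub>1\<close> and \<open>R\<^sub>2\<close> for the two viscous terms, all tested with
  the new velocity \<open>w\<close>.\<close>

lemma phase_energy_identity:
  fixes vh w wh g q q' :: "'a::real_inner" and G G' :: "'b::real_inner"
  assumes pos: "a > 0" "b > 0" "r > 0" "\<tau> > 0"
    and corr: "wh = w + (\<tau> / r) *\<^sub>R (sqrt (b / a) *\<^sub>R q - q')"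
    and mom: "r * ((a + b) / (2 * \<tau>) * (w \<bullet> w) + C) - R\<^sub>1
      = r * b / \<tau> * (vh \<bullet> w) + R\<^sub>2 - sqrt (a * b) * (q \<bullet> w) - g \<bullet> w"
  shows "r * a * (norm wh)\<^sup>2 + \<tau> * m * a * (norm G')\<^sup>2 + \<tau>\<^sup>2 / r * a * (norm q')\<^sup>2
        + \<tau> * m * (norm (sqrt a *\<^sub>R G' + sqrt b *\<^sub>R G))\<^sup>2 + r * b * (norm (vh - w))\<^sup>2
        + 2 * \<tau> * a * (wh \<bullet> q')
      = r * b * (norm vh)\<^sup>2 + \<tau> * m * b * (norm G)\<^sup>2 + \<tau>\<^sup>2 / r * b * (norm q)\<^sup>2
        - 2 * \<tau> * (g \<bullet> w)
        + 2 * \<tau> * ((R\<^sub>1 + m * a * (G' \<bullet> G')) + (R\<^sub>2 + m * sqrt (a * b) * (G \<bullet> G')) - r * C)"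
proof -
  define s where "s = sqrt a"
  define t where "t = sqrt b"
  have st: "s > 0" "t > 0" "a = s\<^sup>2" "b = t\<^sup>2" "sqrt (a * b) = s * t" "sqrt (b / a) = t / s"
    using pos by (auto simp: s_def t_def real_sqrt_mult real_sqrt_divide)
  \<comment> \<open>The weight \<open>sqrt (b / a)\<close> in the correction becomes
    \<open>t\<close> after multiplication by \<open>s\<close>: each pressure gradient carries the
    square root of the fraction of its own time level, so the squared pressure terms
    telescope.\<close>
  have vel: "s *\<^sub>R wh + (\<tau> / r * s) *\<^sub>R q' = s *\<^sub>R w + (\<tau> / r * t) *\<^sub>R q"
    using st(1) by (simp add: corr st(6) algebra_simps)
  have sq: "r * (norm (s *\<^sub>R wh + (\<tau> / r * s) *\<^sub>R q'))\<^sup>2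
      = r * (norm (s *\<^sub>R w + (\<tau> / r * t) *\<^sub>R q))\<^sup>2"
    by (simp only: vel)
  have ex: "r * (norm (c *\<^sub>R y + (\<tau> / r * d) *\<^sub>R z))\<^sup>2
      = r * c\<^sup>2 * (y \<bullet> y) + 2 * \<tau> * c * d * (y \<bullet> z) + \<tau>\<^sup>2 / r * d\<^sup>2 * (z \<bullet> z)"
    for c d and y z :: 'a
    unfolding power2_norm_eq_inner using pos
    by (simp add: inner_add_left inner_add_right inner_commute power2_eq_square field_simps)
  have V: "r * s\<^sup>2 * (wh \<bullet> wh) + 2 * \<tau> * s * s * (wh \<bullet> q') + \<tau>\<^sup>2 / r * s\<^sup>2 * (q' \<bullet> q')
      = r * s\<^sup>2 * (w \<bullet> w) + 2 * \<tau> * s * t * (w \<bullet> q) + \<tau>\<^sup>2 / r * t\<^sup>2 * (q \<bullet> q)"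
    using sq unfolding ex .
  have "2 * \<tau> * (r * ((a + b) / (2 * \<tau>) * X + C) - R\<^sub>1)
      = r * (a + b) * X + 2 * \<tau> * r * C - 2 * \<tau> * R\<^sub>1" for X
    using pos(4) by (simp add: field_simps)
  moreover have "2 * \<tau> * (r * b / \<tau> * X + R\<^sub>2 - sqrt (a * b) * Y - Z)
      = 2 * r * b * X + 2 * \<tau> * R\<^sub>2 - 2 * \<tau> * (sqrt (a * b) * Y) - 2 * \<tau> * Z" for X Y Z
    using pos(4) by (simp add: field_simps)
  ultimately have "r * (a + b) * (w \<bullet> w) + 2 * \<tau> * r * C - 2 * \<tau> * R\<^sub>1
      = 2 * r * b * (vh \<bullet> w) + 2 * \<tau> * R\<^sub>2 - 2 * \<tau> * (sqrt (a * b) * (q \<bullet> w)) - 2 * \<tau> * (g \<bullet> w)"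
    using mom by metis
  then have Mm: "r * (s\<^sup>2 + t\<^sup>2) * (w \<bullet> w) + 2 * \<tau> * r * C - 2 * \<tau> * R\<^sub>1
      = 2 * r * t\<^sup>2 * (vh \<bullet> w) + 2 * \<tau> * R\<^sub>2 - 2 * \<tau> * s * t * (w \<bullet> q) - 2 * \<tau> * (g \<bullet> w)"
    unfolding st(5) by (simp add: st(3,4) inner_commute mult.assoc)
  \<comment> \<open>On adding \<open>V\<close> and \<open>Mm\<close> the cross terms
    \<open>2 * \<tau> * s * t * (w \<bullet> q)\<close> cancel, as do the terms
    \<open>r * s\<^sup>2 * (w \<bullet> w)\<close>. The remaining velocity products complete to
    \<open>r * b\<close> times the square of \<open>vh - w\<close>. The viscous products are added
    on both sides and complete to the square of
    \<open>s *\<^sub>R G' + t *\<^sub>R G\<close>.\<close>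
  show ?thesis
    using V Mm unfolding st(5) unfolding s_def[symmetric] t_def[symmetric]
    unfolding st(3,4) power2_norm_eq_inner
    by (simp add: inner_add_left inner_add_right inner_diff_left inner_diff_right inner_commute
        algebra_simps power2_eq_square)
qed

text \<open>Young's inequality is used with a lower bound \<open>\<kappa>\<close> instead of
  \<open>r * b\<close> itself. The coefficient of the squared drag force can then be the same for
  all phases, as required for applying \<open>drag_force_bound\<close>, which controls only the sum
  over the phases.\<close>

lemma phase_energy_inequality:
  fixes vh w wh g q q' :: "'a::real_inner" and G G' :: "'b::real_inner"
  assumes pos: "a > 0" "b > 0" "r > 0" "\<tau> > 0"
    and corr: "wh = w + (\<tau> / r) *\<^sub>R (sqrt (b / a) *\<^sub>R q - q')"
    and mom: "r * ((a + b) / (2 * \<tau>) * (w \<bullet> w) + C) - R\<^sub>1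
      = r * b / \<tau> * (vh \<bullet> w) + R\<^sub>2 - sqrt (a * b) * (q \<bullet> w) - g \<bullet> w"
    and \<kappa>: "0 < \<kappa>" "\<kappa> \<le> r * b"
  shows "r * a * (norm wh)\<^sup>2 + \<tau> * m * a * (norm G')\<^sup>2 + \<tau>\<^sup>2 / r * a * (norm q')\<^sup>2
        + \<tau> * m * (norm (sqrt a *\<^sub>R G' + sqrt b *\<^sub>R G))\<^sup>2 + 2 * \<tau> * (g \<bullet> vh)
      \<le> r * b * (norm vh)\<^sup>2 + \<tau> * m * b * (norm G)\<^sup>2 + \<tau>\<^sup>2 / r * b * (norm q)\<^sup>2
        + \<tau>\<^sup>2 / \<kappa> * (norm g)\<^sup>2
        + 2 * \<tau> * ((R\<^sub>1 + m * a * (G' \<bullet> G')) + (R\<^sub>2 + m * sqrt (a * b) * (G \<bullet> G')) - r * C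
            - a * (wh \<bullet> q'))"
proof -
  have "2 * \<tau> * (g \<bullet> (vh - w)) \<le> \<tau>\<^sup>2 / \<kappa> * (norm g)\<^sup>2 + \<kappa> * (norm (vh - w))\<^sup>2"
  proof -
    have "0 \<le> \<kappa> * (norm ((\<tau> / \<kappa>) *\<^sub>R g - (vh - w)))\<^sup>2" using \<kappa> by simp
    also have "\<dots> = \<tau>\<^sup>2 / \<kappa> * (norm g)\<^sup>2 - 2 * \<tau> * (g \<bullet> (vh - w)) + \<kappa> * (norm (vh - w))\<^sup>2"
      using \<kappa>(1) unfolding power2_norm_eq_inner inner_diff_left[of "(\<tau> / \<kappa>) *\<^sub>R g"]
        inner_diff_right[of _ "(\<tau> / \<kappa>) *\<^sub>R g"]
      by (simp add: inner_commute[of "vh - w" g] power2_eq_square field_simps)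
    finally show ?thesis by simp
  qed
  also have "\<dots> \<le> \<tau>\<^sup>2 / \<kappa> * (norm g)\<^sup>2 + r * b * (norm (vh - w))\<^sup>2"
    using \<kappa>(2) by (intro add_left_mono mult_right_mono) auto
  finally have "2 * \<tau> * (g \<bullet> vh) - 2 * \<tau> * (g \<bullet> w)
      \<le> \<tau>\<^sup>2 / \<kappa> * (norm g)\<^sup>2 + r * b * (norm (vh - w))\<^sup>2"
    by (simp add: inner_diff_right algebra_simps)
  then show ?thesis
    using phase_energy_identity[OF pos corr mom, of m G' G] by (simp add: algebra_simps)
qed

section \<open>Product rules for the divergence\<close>

lemma jacobian_row_eq_grad:
  fixes v :: "real^'d \<Rightarrow> real^'d"
  assumes "v differentiable (at x)"
  shows "jacobian v (at x) $ i = grad (\<lambda>y. v y $ i) x"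
proof -
  have "((\<lambda>y. v y $ i) has_derivative (\<lambda>h. frechet_derivative v (at x) h $ i)) (at x)"
    using assms by (intro bounded_linear.has_derivative[OF bounded_linear_vec_nth])
      (simp flip: frechet_derivative_works)
  from fun_cong[OF frechet_derivative_at[OF this]] show ?thesis
    by (simp add: vec_eq_iff jacobian_def matrix_def grad_def)
qed

lemma divergence_scaleR:
  fixes F :: "real^'d \<Rightarrow> real^'d"
  assumes "q differentiable (at x)" "F differentiable (at x)"
  shows "divergence (\<lambda>y. q y *\<^sub>R F y) x = q x * divergence F x + F x \<bullet> grad q x"
proof -
  have "((\<lambda>y. q y *\<^sub>R F y) has_derivative
      (\<lambda>h. q x *\<^sub>R frechet_derivative F (at x) h + frechet_derivative q (at x) h *\<^sub>R F x)) (at x)"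
    using assms by (intro has_derivative_scaleR) (auto simp flip: frechet_derivative_works)
  from fun_cong[OF frechet_derivative_at[OF this], symmetric] show ?thesis
    by (simp add: divergence_def trace_def jacobian_def matrix_def grad_def sum.distrib
        sum_distrib_left inner_vec_def mult.commute)
qed

text \<open>Skew-symmetry of the convection. Expanding each row as \<open>w\<close> component times
  \<open>a v\<close> gives the divergence of \<open>a v\<close> times the square of
  \<open>w\<close>, plus one copy of the transport term; pairing the flux with the Jacobian gives a
  second copy. Hence the factor 1/2 in front of the divergence in the scheme makes the tested
  convection half of an integration-by-parts residual.\<close>

lemma convective_flux_divergence:
  fixes v w :: "real^'d \<Rightarrow> real^'d"
  assumes a: "a differentiable (at x)" and v: "v differentiable (at x)"
    and w: "w differentiable (at x)"
  shows "w x \<bullet> row_divergence (\<lambda>y. \<chi> i. (a y * w y $ i) *\<^sub>R v y) x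
      + (\<chi> i. (a x * w x $ i) *\<^sub>R v x) \<bullet> jacobian w (at x)
    = 2 * (a x * ((jacobian w (at x) *v v x) \<bullet> w x)
         + 1 / 2 * divergence (\<lambda>y. a y *\<^sub>R v y) x * (w x \<bullet> w x))"
proof -
  have wi: "(\<lambda>y. w y $ i) differentiable (at x)" for i
    using w bounded_linear.has_derivative[OF bounded_linear_vec_nth]
    unfolding differentiable_def by blast
  have av: "(\<lambda>y. a y *\<^sub>R v y) differentiable (at x)"
    using a v by (rule differentiable_scaleR)
  let ?d = "divergence (\<lambda>y. a y *\<^sub>R v y) x"
  have "divergence (\<lambda>y. (a y * w y $ i) *\<^sub>R v y) x
      = w x $ i * divergence (\<lambda>y. a y *\<^sub>R v y) x + a x * (v x \<bullet> jacobian w (at x) $ i)" for i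
    using divergence_scaleR[OF wi[of i] av] by (simp add: jacobian_row_eq_grad[OF w] mult.commute)
  then have "w x \<bullet> row_divergence (\<lambda>y. \<chi> i. (a y * w y $ i) *\<^sub>R v y) x
      = (\<Sum>i\<in>UNIV. w x $ i * (w x $ i * ?d + a x * (v x \<bullet> jacobian w (at x) $ i)))"
    by (simp add: row_divergence_def inner_vec_def[of "w x"])
  moreover have "(\<chi> i. (a x * w x $ i) *\<^sub>R v x) \<bullet> jacobian w (at x)
      = (\<Sum>i\<in>UNIV. a x * w x $ i * (v x \<bullet> jacobian w (at x) $ i))"
    by (simp only: inner_vec_def[of _ "jacobian w (at x)"] vec_lambda_beta inner_scaleR_left)
  moreover have "(jacobian w (at x) *v v x) \<bullet> w x
      = (\<Sum>i\<in>UNIV. (v x \<bullet> jacobian w (at x) $ i) * w x $ i)"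
    by (simp add: inner_vec_def[of _ "w x"] matrix_vector_mul_component inner_commute[of "v x"])
  moreover have "w x \<bullet> w x = (\<Sum>i\<in>UNIV. w x $ i * w x $ i)"
    by (simp add: inner_vec_def)
  ultimately show ?thesis
    by (simp add: sum_distrib_left sum.distrib distrib_left mult_ac)
qed

section \<open>Boundary values and residuals of integration by parts\<close>

lemma tendsto_at_frontier:
  assumes "continuous_on (closure \<Omega>) f" "x \<in> frontier \<Omega>"
  shows "(f \<longlongrightarrow> f x) (at x within \<Omega>)"
proof -
  have "(f \<longlongrightarrow> f x) (at x within closure \<Omega>)"
    using assms by (auto simp: continuous_on_def frontier_def)
  then show ?thesis by (rule tendsto_within_subset) (rule closure_subset)
qed

lemma boundary_value_eqI:
  assumes "open \<Omega>" "x \<in> frontier \<Omega>" "(f \<longlongrightarrow> l) (at x within \<Omega>)"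
  shows "boundary_value \<Omega> f x = l"
proof -
  \<comment> \<open>A frontier point of an open set lies outside it and is therefore a limit point,
    which makes limits from inside unique.\<close>
  have "at x within \<Omega> \<noteq> bot"
    using assms(1,2) by (auto simp: frontier_def closure_def interior_open trivial_limit_within)
  then show ?thesis
    unfolding boundary_value_def using assms(3) by (intro tendsto_Lim)
qed

lemma boundary_value_scaleR:
  fixes g :: "real^'d \<Rightarrow> 'b::real_normed_vector"
  assumes op: "open \<Omega>" and x: "x \<in> frontier \<Omega>" and c: "continuous_on (closure \<Omega>) c"
    and g: "has_boundary_value \<Omega> g x"
  shows "boundary_value \<Omega> (\<lambda>y. c y *\<^sub>R g y) x = c x *\<^sub>R boundary_value \<Omega> g x"
proof -
  obtain l where l: "(g \<longlongrightarrow> l) (at x within \<Omega>)"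
    using g by (auto simp: has_boundary_value_def)
  show ?thesis
    using boundary_value_eqI[OF op x l]
      boundary_value_eqI[OF op x tendsto_scaleR[OF tendsto_at_frontier[OF c x] l]] by simp
qed

text \<open>Integrability and value are kept together, so that residuals of several fluxes can be
  combined linearly.\<close>

lemma int_by_parts_residual:
  assumes "int_by_parts \<Omega> \<sigma> nrm F q"
  shows "has_bochner_integral (lebesgue_on \<Omega>) (\<lambda>x. q x * divergence F x + F x \<bullet> grad q x)
    (LINT x|\<sigma>. boundary_value \<Omega> q x * (boundary_value \<Omega> F x \<bullet> nrm x))"
  using assms unfolding int_by_parts_def by (auto simp: has_bochner_integral_iff)

text \<open>Every component of \<open>v\<close> has boundary value zero, so each row's boundary
  integrand vanishes whatever the boundary value of \<open>A\<close>.\<close>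

lemma row_int_by_parts_residual:
  fixes v :: "real^'d \<Rightarrow> real^'d"
  assumes ibp: "row_int_by_parts \<Omega> \<sigma> nrm A v"
    and op: "open \<Omega>" and fr: "AE x in \<sigma>. x \<in> frontier \<Omega>"
    and diff: "\<And>x. x \<in> \<Omega> \<Longrightarrow> v differentiable (at x)"
    and cont: "continuous_on (closure \<Omega>) v" and zero: "\<And>x. x \<in> frontier \<Omega> \<Longrightarrow> v x = 0"
  shows "has_bochner_integral (lebesgue_on \<Omega>)
    (\<lambda>x. v x \<bullet> row_divergence A x + A x \<bullet> jacobian v (at x)) 0"
proof -
  have bv: "boundary_value \<Omega> (\<lambda>y. v y $ i) x = 0" if "x \<in> frontier \<Omega>" for i x
    using boundary_value_eqI[OF op that tendsto_vec_nth[OF tendsto_at_frontier[OF cont that]]]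
      zero[OF that] by simp
  have "(LINT x|\<sigma>. boundary_value \<Omega> (\<lambda>y. v y $ i) x
      * (boundary_value \<Omega> (\<lambda>y. A y $ i) x \<bullet> nrm x)) = 0" for i
    using fr by (intro integral_eq_zero_AE) (auto simp: bv)
  then have "has_bochner_integral (lebesgue_on \<Omega>)
      (\<lambda>x. v x $ i * divergence (\<lambda>y. A y $ i) x + A x $ i \<bullet> grad (\<lambda>y. v y $ i) x) 0" for i
    using int_by_parts_residual[of \<Omega> \<sigma> nrm "\<lambda>x. A x $ i" "\<lambda>x. v x $ i"] ibp
    by (simp add: row_int_by_parts_def)
  then have "has_bochner_integral (lebesgue_on \<Omega>)
    (\<lambda>x. \<Sum>i\<in>UNIV. v x $ i * divergence (\<lambda>y. A y $ i) x + A x $ i \<bullet> grad (\<lambda>y. v y $ i) x)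
    (\<Sum>i\<in>(UNIV :: 'd set). 0)"
    by (intro has_bochner_integral_sum)
  moreover have "v x \<bullet> row_divergence A x + A x \<bullet> jacobian v (at x)
      = (\<Sum>i\<in>UNIV. v x $ i * divergence (\<lambda>y. A y $ i) x + A x $ i \<bullet> grad (\<lambda>y. v y $ i) x)"
    if "x \<in> \<Omega>" for x
    by (simp add: row_divergence_def inner_vec_def[of "v x"] inner_vec_def[of "A x"]
        jacobian_row_eq_grad[OF diff[OF that]] sum.distrib)
  ultimately show ?thesis
    by (subst has_bochner_integral_cong[OF refl _ refl]) auto
qed

text \<open>The weak form of the pressure equation. In the combination of the three residuals the
  divergences cancel by the interior equation, the boundary fluxes of the two gradients cancel by
  the boundary condition, and \<open>F\<close> has no boundary flux because it vanishes
  there.\<close>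

lemma pressure_residual:
  fixes g g' F :: "real^'d \<Rightarrow> real^'d"
  assumes op: "open \<Omega>" and fr: "AE x in \<sigma>. x \<in> frontier \<Omega>"
    and ibp: "int_by_parts \<Omega> \<sigma> nrm (\<lambda>x. s' x *\<^sub>R g' x) q" "int_by_parts \<Omega> \<sigma> nrm (\<lambda>x. s x *\<^sub>R g x) q"
      "int_by_parts \<Omega> \<sigma> nrm F q"
    and cont: "continuous_on (closure \<Omega>) s'" "continuous_on (closure \<Omega>) s"
      "continuous_on (closure \<Omega>) F"
    and zero: "\<And>x. x \<in> frontier \<Omega> \<Longrightarrow> F x = 0"
    and bv: "AE x in \<sigma>. has_boundary_value \<Omega> g' x" "AE x in \<sigma>. has_boundary_value \<Omega> g x"
    and interior: "\<And>x. x \<in> \<Omega> \<Longrightarrow> divergence (\<lambda>y. s' y *\<^sub>R g' y) x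
      = divergence (\<lambda>y. s y *\<^sub>R g y) x + c * divergence F x"
    and boundary: "AE x in \<sigma>. s' x * (nrm x \<bullet> boundary_value \<Omega> g' x)
      = s x * (nrm x \<bullet> boundary_value \<Omega> g x)"
  shows "has_bochner_integral (lebesgue_on \<Omega>)
    (\<lambda>x. (s' x *\<^sub>R g' x - s x *\<^sub>R g x - c *\<^sub>R F x) \<bullet> grad q x) 0"
proof -
  let ?b = "\<lambda>F x. boundary_value \<Omega> q x * (boundary_value \<Omega> F x \<bullet> nrm x)"
  have "(LINT x|\<sigma>. ?b F x) = 0"
    using fr by (intro integral_eq_zero_AE, eventually_elim)
      (use boundary_value_eqI[OF op _ tendsto_at_frontier[OF cont(3)]] zero in auto)
  \<comment> \<open>The coefficients are continuous up to the boundary and therefore factor out of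
    the boundary values, after which the boundary condition applies.\<close>
  moreover have "(LINT x|\<sigma>. ?b (\<lambda>x. s' x *\<^sub>R g' x) x) = (LINT x|\<sigma>. ?b (\<lambda>x. s x *\<^sub>R g x) x)"
  proof (rule integral_cong_AE)
    show "AE x in \<sigma>. ?b (\<lambda>x. s' x *\<^sub>R g' x) x = ?b (\<lambda>x. s x *\<^sub>R g x) x"
      using fr bv boundary
      by eventually_elim
        (simp add: boundary_value_scaleR[OF op _ cont(1)] boundary_value_scaleR[OF op _ cont(2)]
          inner_commute)
  qed (use ibp in \<open>auto simp: int_by_parts_def\<close>)
  moreover have "has_bochner_integral (lebesgue_on \<Omega>)
      (\<lambda>x. (q x * divergence (\<lambda>y. s' y *\<^sub>R g' y) x + (s' x *\<^sub>R g' x) \<bullet> grad q x)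
        - (q x * divergence (\<lambda>y. s y *\<^sub>R g y) x + (s x *\<^sub>R g x) \<bullet> grad q x)
        - c * (q x * divergence F x + F x \<bullet> grad q x))
      ((LINT x|\<sigma>. ?b (\<lambda>x. s' x *\<^sub>R g' x) x) - (LINT x|\<sigma>. ?b (\<lambda>x. s x *\<^sub>R g x) x)
        - c * (LINT x|\<sigma>. ?b F x))"
    by (intro has_bochner_integral_diff has_bochner_integral_mult_right int_by_parts_residual ibp)
  ultimately have "has_bochner_integral (lebesgue_on \<Omega>)
      (\<lambda>x. (q x * divergence (\<lambda>y. s' y *\<^sub>R g' y) x + (s' x *\<^sub>R g' x) \<bullet> grad q x)
        - (q x * divergence (\<lambda>y. s y *\<^sub>R g y) x + (s x *\<^sub>R g x) \<bullet> grad q x)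
        - c * (q x * divergence F x + F x \<bullet> grad q x)) 0"
    by simp
  then show ?thesis
    by (rule has_bochner_integral_cong[THEN iffD1, rotated 3])
      (auto simp: interior algebra_simps inner_diff_left)
qed

section \<open>Pointwise lower bounds and square integrability\<close>

text \<open>By continuity the set of violations is open; being null, it is empty. This gives the
  lower bound on the volume fractions at every point, so the energy balance can be carried out
  pointwise.\<close>

lemma AE_ge_imp_ge_open:
  fixes f :: "'a::euclidean_space \<Rightarrow> real"
  assumes op: "open S" and f: "continuous_on S f"
    and AE: "AE x in lebesgue_on S. c \<le> f x" and x: "x \<in> S"
  shows "c \<le> f x"
proof (rule ccontr)
  assume less: "\<not> c \<le> f x"
  let ?U = "S \<inter> f -` {..<c}"
  have oU: "open ?U" using op f by (intro continuous_open_preimage) auto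
  have "AE y in lebesgue. y \<in> S \<longrightarrow> c \<le> f y"
    using AE op by (simp add: AE_restrict_space_iff)
  then have "AE y in lebesgue. y \<notin> ?U" by eventually_elim auto
  then have "negligible ?U"
    using oU by (simp add: AE_iff_null_sets negligible_iff_null_sets)
  then have "?U = {}" using open_not_negligible[OF oU] by blast
  with x less show False by auto
qed

lemma square_integrable_bound:
  fixes g :: "real^'d \<Rightarrow> 'b::{real_normed_vector,second_countable_topology}"
  assumes "square_integrable \<Omega> f" "g \<in> borel_measurable (lebesgue_on \<Omega>)"
    and "\<And>x. x \<in> \<Omega> \<Longrightarrow> norm (g x) \<le> K * norm (f x)"
  shows "square_integrable \<Omega> g"
proof -
  have "integrable (lebesgue_on \<Omega>) (\<lambda>x. (norm (g x))\<^sup>2)"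
  proof (rule Bochner_Integration.integrable_bound)
    show "integrable (lebesgue_on \<Omega>) (\<lambda>x. K\<^sup>2 * (norm (f x))\<^sup>2)"
      using assms(1) by (simp add: square_integrable_def)
    have "(norm (g x))\<^sup>2 \<le> K\<^sup>2 * (norm (f x))\<^sup>2" if "x \<in> \<Omega>" for x
      using power_mono[OF assms(3)[OF that], of 2] by (simp add: power_mult_distrib)
    then show "AE x in lebesgue_on \<Omega>. norm ((norm (g x))\<^sup>2) \<le> norm (K\<^sup>2 * (norm (f x))\<^sup>2)"
      by (intro AE_I2) auto
  qed (use assms(2) in measurable)
  then show ?thesis using assms(2) by (simp add: square_integrable_def)
qed

lemma square_integrable_add:
  fixes f g :: "real^'d \<Rightarrow> 'b::{real_normed_vector,second_countable_topology}"
  assumes "square_integrable \<Omega> f" "square_integrable \<Omega> g"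
  shows "square_integrable \<Omega> (\<lambda>x. f x + g x)"
proof -
  have meas: "(\<lambda>x. f x + g x) \<in> borel_measurable (lebesgue_on \<Omega>)"
    using assms by (auto simp: square_integrable_def)
  have "integrable (lebesgue_on \<Omega>) (\<lambda>x. (norm (f x + g x))\<^sup>2)"
  proof (rule Bochner_Integration.integrable_bound)
    show "integrable (lebesgue_on \<Omega>) (\<lambda>x. 2 * (norm (f x))\<^sup>2 + 2 * (norm (g x))\<^sup>2)"
      using assms by (simp add: square_integrable_def)
    have "(norm (f x + g x))\<^sup>2 \<le> 2 * (norm (f x))\<^sup>2 + 2 * (norm (g x))\<^sup>2" for x
      using power_mono[OF norm_triangle_ineq[of "f x" "g x"], of 2]
        zero_le_power2[of "norm (f x) - norm (g x)"]
      by (simp add: power2_sum power2_diff)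
    then show "AE x in lebesgue_on \<Omega>. norm ((norm (f x + g x))\<^sup>2)
        \<le> norm (2 * (norm (f x))\<^sup>2 + 2 * (norm (g x))\<^sup>2)"
      by (intro AE_I2) auto
  qed (use meas in measurable)
  then show ?thesis using meas by (simp add: square_integrable_def)
qed

lemma square_integrable_scaleR:
  fixes f :: "real^'d \<Rightarrow> 'b::{real_normed_vector,second_countable_topology}"
  assumes "square_integrable \<Omega> f" "c \<in> borel_measurable (lebesgue_on \<Omega>)"
    and "\<And>x. x \<in> \<Omega> \<Longrightarrow> \<bar>c x\<bar> \<le> K"
  shows "square_integrable \<Omega> (\<lambda>x. c x *\<^sub>R f x)"
proof (rule square_integrable_bound[OF assms(1), where K = K])
  show "(\<lambda>x. c x *\<^sub>R f x) \<in> borel_measurable (lebesgue_on \<Omega>)"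
    using assms(1,2) by (auto simp: square_integrable_def)
qed (auto intro!: mult_right_mono assms(3))

lemma square_integrable_diff:
  fixes f g :: "real^'d \<Rightarrow> 'b::{real_normed_vector,second_countable_topology}"
  assumes "square_integrable \<Omega> f" "square_integrable \<Omega> g"
  shows "square_integrable \<Omega> (\<lambda>x. f x - g x)"
  using square_integrable_add[OF assms(1) square_integrable_scaleR[OF assms(2), of "\<lambda>_. - 1" 1]]
  by simp

lemma square_integrable_cong:
  assumes "square_integrable \<Omega> f" "\<And>x. x \<in> \<Omega> \<Longrightarrow> f x = g x"
  shows "square_integrable \<Omega> g"
proof -
  have "f \<in> borel_measurable (lebesgue_on \<Omega>) \<longleftrightarrow> g \<in> borel_measurable (lebesgue_on \<Omega>)"
    using assms(2) by (intro measurable_cong) auto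
  moreover have "integrable (lebesgue_on \<Omega>) (\<lambda>x. (norm (f x))\<^sup>2)
      \<longleftrightarrow> integrable (lebesgue_on \<Omega>) (\<lambda>x. (norm (g x))\<^sup>2)"
    using assms(2) by (intro Bochner_Integration.integrable_cong) auto
  ultimately show ?thesis using assms(1) by (simp add: square_integrable_def)
qed

lemma continuous_on_closure_imp_measurable:
  fixes f :: "real^'d \<Rightarrow> 'b::{euclidean_space}"
  assumes "open \<Omega>" "continuous_on (closure \<Omega>) f"
  shows "f \<in> borel_measurable (lebesgue_on \<Omega>)"
  using assms by (intro continuous_imp_measurable_on_sets_lebesgue)
    (auto intro: continuous_on_subset[OF _ closure_subset])

lemma continuous_on_closure_imp_bounded:
  fixes f :: "real^'d \<Rightarrow> 'b::{euclidean_space}"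
  assumes "bounded \<Omega>" "continuous_on (closure \<Omega>) f"
  obtains K where "\<And>x. x \<in> \<Omega> \<Longrightarrow> norm (f x) \<le> K"
proof -
  have "compact (f ` closure \<Omega>)"
    using assms by (intro compact_continuous_image) (auto simp: compact_closure)
  then show ?thesis
    using that closure_subset by (metis bounded_iff compact_imp_bounded image_eqI subsetD)
qed

lemma square_integrable_continuous:
  fixes f :: "real^'d \<Rightarrow> 'b::{euclidean_space}"
  assumes "open \<Omega>" "bounded \<Omega>" "continuous_on (closure \<Omega>) f"
  shows "square_integrable \<Omega> f"
proof -
  obtain K where K: "\<And>x. x \<in> \<Omega> \<Longrightarrow> norm (f x) \<le> K"
    using continuous_on_closure_imp_bounded[OF assms(2,3)] by blast
  have "\<Omega> \<in> lmeasurable" using assms by (simp add: lmeasurable_open)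
  then have "integrable (lebesgue_on \<Omega>) (\<lambda>x. 1 :: real)"
    by (intro finite_measure.integrable_const finite_measure_lebesgue_on)
  then have "square_integrable \<Omega> (\<lambda>x. 1 :: real)"
    by (simp add: square_integrable_def)
  then show ?thesis
    by (rule square_integrable_bound[where K = K])
      (use K continuous_on_closure_imp_measurable[OF assms(1,3)] in auto)
qed

text \<open>Lets the explicit transposed gradient of the scheme be charged to the viscous energy of
  the old level.\<close>

lemma norm_transpose: "norm (transpose A) = norm (A :: real^'n^'m)"
proof -
  have "transpose A \<bullet> transpose A = A \<bullet> A"
    unfolding inner_vec_def by (subst sum.swap) (simp add: transpose_def)
  then show ?thesis by (simp add: norm_eq_sqrt_inner)
qed

lemma square_integrable_transpose:
  fixes f :: "real^'d \<Rightarrow> real^'n^'m"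
  assumes "square_integrable \<Omega> f"
  shows "square_integrable \<Omega> (\<lambda>x. transpose (f x))"
proof (rule square_integrable_bound[OF assms, where K = 1])
  have "continuous_on UNIV (transpose :: real^'n^'m \<Rightarrow> real^'m^'n)"
    unfolding transpose_def by (intro continuous_intros)
  then show "(\<lambda>x. transpose (f x)) \<in> borel_measurable (lebesgue_on \<Omega>)"
    using assms by (auto intro: borel_measurable_continuous_on simp: square_integrable_def)
qed (simp add: norm_transpose)

lemma L2norm_power2: "(L2norm \<Omega> f)\<^sup>2 = (LINT x|lebesgue_on \<Omega>. (norm (f x))\<^sup>2)"
  by (simp add: L2norm_def)

section \<open>The scheme, its densities and residuals\<close>

locale fractional_step =
  fixes \<Omega> :: "(real^'d) set" and \<sigma> :: "(real^'d) measure" and nrm :: "real^'d \<Rightarrow> real^'d"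
    and M N :: nat and \<tau> D \<alpha>min \<rho>min :: real and \<rho> \<mu> :: "nat \<Rightarrow> real"
    and \<gamma> :: "nat \<Rightarrow> nat \<Rightarrow> nat \<Rightarrow> real^'d \<Rightarrow> real"
    and \<alpha> :: "nat \<Rightarrow> nat \<Rightarrow> real^'d \<Rightarrow> real"
    and u uh :: "nat \<Rightarrow> nat \<Rightarrow> real^'d \<Rightarrow> real^'d"
    and p :: "nat \<Rightarrow> real^'d \<Rightarrow> real"
  assumes domain: "gauss_domain \<Omega> \<sigma> nrm"
    and tau_pos: "\<tau> > 0" and D_pos: "D > 0"
    and rho_pos: "\<And>k. k \<in> {1..M} \<Longrightarrow> \<rho> k > 0"
    and mu_pos: "\<And>k. k \<in> {1..M} \<Longrightarrow> \<mu> k > 0"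
    and drag: "admissible_drag \<Omega> M N \<gamma>"
    and regular: "scheme_regular \<Omega> \<sigma> nrm M N \<rho> \<mu> \<alpha> u p"
    and solution: "scheme_solution \<Omega> \<sigma> nrm M N \<tau> \<rho> \<mu> D \<gamma> \<alpha> u uh p"
    and alpha_min_pos: "\<alpha>min > 0"
    and AE_alpha_min: "\<And>k n. k \<in> {1..M} \<Longrightarrow> n \<le> N \<Longrightarrow> AE x in lebesgue_on \<Omega>. \<alpha> k n x \<ge> \<alpha>min"
    and rho_min_pos: "\<rho>min > 0" and rho_min: "\<And>k. k \<in> {1..M} \<Longrightarrow> \<rho>min \<le> \<rho> k"
begin

abbreviation J :: "nat \<Rightarrow> nat \<Rightarrow> real^'d \<Rightarrow> real^'d^'d" where
  "J k n x \<equiv> jacobian (u k n) (at x)"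

abbreviation drag_coefficient :: "nat \<Rightarrow> nat \<Rightarrow> nat \<Rightarrow> real^'d \<Rightarrow> real" where
  "drag_coefficient k l n \<equiv> truncated_drag D (\<gamma> k l n)"

text \<open>Kept as a density: the step estimate is an inequality between functions and is
  integrated only once.\<close>

definition energy :: "nat \<Rightarrow> real^'d \<Rightarrow> real" where
  "energy n x = (\<Sum>k=1..M. \<rho> k * (norm (sqrt (\<alpha> k n x) *\<^sub>R uh k n x))\<^sup>2
      + \<tau> * \<mu> k * (norm (sqrt (\<alpha> k n x) *\<^sub>R J k n x))\<^sup>2
      + \<tau>\<^sup>2 / \<rho> k * (norm (sqrt (\<alpha> k n x) *\<^sub>R grad (p n) x))\<^sup>2)"

text \<open>Indexed by the old level of a time step, so \<open>dissipation n\<close> is the summand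
  \<open>n + 1\<close> of the final estimate.\<close>

definition dissipation :: "nat \<Rightarrow> real^'d \<Rightarrow> real" where
  "dissipation n x = (\<Sum>k=1..M.
      \<mu> k * (norm (sqrt (\<alpha> k (Suc n) x) *\<^sub>R J k (Suc n) x
                   + sqrt (\<alpha> k n x) *\<^sub>R transpose (J k n x)))\<^sup>2
    + (\<Sum>l=1..M. (norm (sqrt (drag_coefficient k l n x) *\<^sub>R (uh k n x - uh l n x)))\<^sup>2))"

definition convective_residual :: "nat \<Rightarrow> nat \<Rightarrow> real^'d \<Rightarrow> real" where
  "convective_residual k n x =
     \<alpha> k (Suc n) x * ((J k (Suc n) x *v u k n x) \<bullet> u k (Suc n) x)
     + 1 / 2 * divergence (\<lambda>y. \<alpha> k (Suc n) y *\<^sub>R u k n y) x * (u k (Suc n) x \<bullet> u k (Suc n) x)"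

text \<open>The integrand left by moving the divergence from \<open>A\<close> onto the new velocity;
  its integral is a boundary term.\<close>

definition viscous_residual :: "nat \<Rightarrow> nat \<Rightarrow> (real^'d \<Rightarrow> real^'d^'d) \<Rightarrow> real^'d \<Rightarrow> real" where
  "viscous_residual k n A x = u k (Suc n) x \<bullet> row_divergence A x + A x \<bullet> J k (Suc n) x"

text \<open>Gathers what disappears from the balance only after integration.\<close>

definition residual :: "nat \<Rightarrow> real^'d \<Rightarrow> real" where
  "residual n x = (\<Sum>k=1..M.
      viscous_residual k n (\<lambda>y. (\<mu> k * \<alpha> k (Suc n) y) *\<^sub>R J k (Suc n) y) x
    + viscous_residual k n (\<lambda>y. (\<mu> k * sqrt (\<alpha> k (Suc n) y * \<alpha> k n y)) *\<^sub>R transpose (J k n y)) x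
    - \<rho> k * convective_residual k n x
    - \<alpha> k (Suc n) x * (uh k (Suc n) x \<bullet> grad (p (Suc n)) x))"

text \<open>The factor \<open>4 * (D * (real M - 1))\<^sup>2\<close> comes from
  \<open>drag_force_bound\<close>. One factor \<open>1 / (\<rho>min * \<alpha>min)\<close> comes
  from Young's inequality, the other from bounding the squared hatted velocities by the energy
  density.\<close>

definition growth :: real where
  "growth = 4 * (D * (real M - 1) / (\<rho>min * \<alpha>min))\<^sup>2 * \<tau>\<^sup>2"

lemma open_domain: "open \<Omega>" and bounded_domain: "bounded \<Omega>"
  and AE_frontier: "AE x in \<sigma>. x \<in> frontier \<Omega>"
  using domain by (auto simp: gauss_domain_def)

lemma phase_regular:
  assumes "k \<in> {1..M}" "n \<le> N"
  shows "continuous_on (closure \<Omega>) (\<alpha> k n)" "\<And>x. x \<in> \<Omega> \<Longrightarrow> \<alpha> k n differentiable (at x)"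
    "continuous_on (closure \<Omega>) (u k n)" "\<And>x. x \<in> \<Omega> \<Longrightarrow> u k n differentiable (at x)"
    "square_integrable \<Omega> (J k n)"
  using regular assms by (auto simp: scheme_regular_def)

lemma pressure_regular:
  assumes "n \<le> N"
  shows "square_integrable \<Omega> (grad (p n))" "AE x in \<sigma>. has_boundary_value \<Omega> (grad (p n)) x"
  using regular assms by (auto simp: scheme_regular_def)

lemma u_frontier: "k \<in> {1..M} \<Longrightarrow> n \<le> N \<Longrightarrow> x \<in> frontier \<Omega> \<Longrightarrow> u k n x = 0"
  using solution by (auto simp: scheme_solution_def)

lemma uh_0: "k \<in> {1..M} \<Longrightarrow> x \<in> \<Omega> \<Longrightarrow> uh k 0 x = u k 0 x"
  using solution by (auto simp: scheme_solution_def)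

lemma alpha_ge_min:
  assumes "k \<in> {1..M}" "n \<le> N" "x \<in> \<Omega>"
  shows "\<alpha>min \<le> \<alpha> k n x"
  by (rule AE_ge_imp_ge_open[OF open_domain _ AE_alpha_min[OF assms(1,2)] assms(3)])
    (rule continuous_on_subset[OF phase_regular(1)[OF assms(1,2)] closure_subset])

lemma alpha_pos: "k \<in> {1..M} \<Longrightarrow> n \<le> N \<Longrightarrow> x \<in> \<Omega> \<Longrightarrow> 0 < \<alpha> k n x"
  using alpha_ge_min alpha_min_pos by (meson less_le_trans)

lemma drag_coefficient:
  assumes "n < N" "k \<in> {1..M}" "l \<in> {1..M}" "x \<in> \<Omega>"
  shows "0 \<le> drag_coefficient k l n x" "drag_coefficient k l n x \<le> D"
    "drag_coefficient k l n x = drag_coefficient l k n x" "drag_coefficient k k n x = 0"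
proof -
  have "\<gamma> k l n x \<ge> 0" "\<gamma> k k n x = 0" "\<gamma> k l n x = \<gamma> l k n x"
    using drag assms unfolding admissible_drag_def by blast+
  then show "0 \<le> drag_coefficient k l n x" "drag_coefficient k l n x \<le> D"
    "drag_coefficient k l n x = drag_coefficient l k n x" "drag_coefficient k k n x = 0"
    using D_pos by (auto simp: truncated_drag_def)
qed

section \<open>The pointwise energy step\<close>

lemma velocity_correction:
  assumes "n < N" "k \<in> {1..M}" "x \<in> \<Omega>"
  shows "uh k (Suc n) x = u k (Suc n) x
    + (\<tau> / \<rho> k) *\<^sub>R (sqrt (\<alpha> k n x / \<alpha> k (Suc n) x) *\<^sub>R grad (p n) x - grad (p (Suc n)) x)"
  using solution assms by (auto simp: scheme_solution_def velocity_correction_def)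

lemma tested_momentum_equation:
  assumes n: "n < N" and k: "k \<in> {1..M}" and x: "x \<in> \<Omega>"
  shows "\<rho> k * ((\<alpha> k (Suc n) x + \<alpha> k n x) / (2 * \<tau>) * (u k (Suc n) x \<bullet> u k (Suc n) x)
        + convective_residual k n x)
      - u k (Suc n) x \<bullet> row_divergence (\<lambda>y. (\<mu> k * \<alpha> k (Suc n) y) *\<^sub>R J k (Suc n) y) x
    = \<rho> k * \<alpha> k n x / \<tau> * (uh k n x \<bullet> u k (Suc n) x)
      + u k (Suc n) x \<bullet> row_divergence
          (\<lambda>y. (\<mu> k * sqrt (\<alpha> k (Suc n) y * \<alpha> k n y)) *\<^sub>R transpose (J k n y)) x
      - sqrt (\<alpha> k (Suc n) x * \<alpha> k n x) * (grad (p n) x \<bullet> u k (Suc n) x)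
      - (\<Sum>l=1..M. drag_coefficient k l n x *\<^sub>R (uh k n x - uh l n x)) \<bullet> u k (Suc n) x"
proof -
  let ?w = "u k (Suc n) x"
  have "momentum_equation \<Omega> M \<tau> \<rho> \<mu> D \<gamma> \<alpha> u uh p k n"
    using solution n k by (auto simp: scheme_solution_def)
  then have "(\<rho> k *\<^sub>R (((\<alpha> k (Suc n) x + \<alpha> k n x) / (2 * \<tau>)) *\<^sub>R ?w
          + \<alpha> k (Suc n) x *\<^sub>R (J k (Suc n) x *v u k n x)
          + ((1/2) * divergence (\<lambda>y. \<alpha> k (Suc n) y *\<^sub>R u k n y) x) *\<^sub>R ?w)
        - row_divergence (\<lambda>y. (\<mu> k * \<alpha> k (Suc n) y) *\<^sub>R J k (Suc n) y) x) \<bullet> ?w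
      = ((\<rho> k * \<alpha> k n x / \<tau>) *\<^sub>R uh k n x
        + row_divergence (\<lambda>y. (\<mu> k * sqrt (\<alpha> k (Suc n) y * \<alpha> k n y)) *\<^sub>R transpose (J k n y)) x
        - sqrt (\<alpha> k (Suc n) x * \<alpha> k n x) *\<^sub>R grad (p n) x
        - (\<Sum>l=1..M. drag_coefficient k l n x *\<^sub>R (uh k n x - uh l n x))) \<bullet> ?w"
    using x unfolding momentum_equation_def by (intro arg_cong[where f = "\<lambda>z. z \<bullet> ?w"]) blast
  then show ?thesis
    unfolding convective_residual_def inner_add_left inner_diff_left inner_scaleR_left
      inner_commute[of ?w "row_divergence _ _"]
    by (simp only: add.assoc)
qed

lemma phase_step:
  assumes n: "n < N" and k: "k \<in> {1..M}" and x: "x \<in> \<Omega>"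
  defines "g \<equiv> \<Sum>l=1..M. drag_coefficient k l n x *\<^sub>R (uh k n x - uh l n x)"
  shows "\<rho> k * (norm (sqrt (\<alpha> k (Suc n) x) *\<^sub>R uh k (Suc n) x))\<^sup>2
      + \<tau> * \<mu> k * (norm (sqrt (\<alpha> k (Suc n) x) *\<^sub>R J k (Suc n) x))\<^sup>2
      + \<tau>\<^sup>2 / \<rho> k * (norm (sqrt (\<alpha> k (Suc n) x) *\<^sub>R grad (p (Suc n)) x))\<^sup>2
      + \<tau> * (\<mu> k * (norm (sqrt (\<alpha> k (Suc n) x) *\<^sub>R J k (Suc n) x
                   + sqrt (\<alpha> k n x) *\<^sub>R transpose (J k n x)))\<^sup>2)
      + 2 * \<tau> * (g \<bullet> uh k n x)
    \<le> \<rho> k * (norm (sqrt (\<alpha> k n x) *\<^sub>R uh k n x))\<^sup>2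
      + \<tau> * \<mu> k * (norm (sqrt (\<alpha> k n x) *\<^sub>R J k n x))\<^sup>2
      + \<tau>\<^sup>2 / \<rho> k * (norm (sqrt (\<alpha> k n x) *\<^sub>R grad (p n) x))\<^sup>2
      + \<tau>\<^sup>2 / (\<rho>min * \<alpha>min) * (norm g)\<^sup>2
      + 2 * \<tau> * (viscous_residual k n (\<lambda>y. (\<mu> k * \<alpha> k (Suc n) y) *\<^sub>R J k (Suc n) y) x
        + viscous_residual k n (\<lambda>y. (\<mu> k * sqrt (\<alpha> k (Suc n) y * \<alpha> k n y)) *\<^sub>R transpose (J k n y)) x
        - \<rho> k * convective_residual k n x
        - \<alpha> k (Suc n) x * (uh k (Suc n) x \<bullet> grad (p (Suc n)) x))"
proof -
  have a: "0 < \<alpha> k (Suc n) x" "0 < \<alpha> k n x"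
    using alpha_pos k n x by auto
  have \<kappa>: "0 < \<rho>min * \<alpha>min" "\<rho>min * \<alpha>min \<le> \<rho> k * \<alpha> k n x"
    using rho_min_pos alpha_min_pos rho_min[OF k] alpha_ge_min[OF k _ x, of n] n
    by (auto intro!: mult_mono)
  have sq: "(norm (sqrt c *\<^sub>R z))\<^sup>2 = c * (norm z)\<^sup>2" if "0 < c" for c and z :: "'z::real_inner"
    using that by (simp add: power_mult_distrib)
  \<comment> \<open>Here \<open>\<kappa>\<close> is \<open>\<rho>min * \<alpha>min\<close>, and
    \<open>G\<close> is the transposed old Jacobian. The tested row divergences, together with the
    added gradient products, are the two viscous residuals.\<close>
  show ?thesis
    using phase_energy_inequality[OF a rho_pos[OF k] tau_pos velocity_correction[OF n k x]
        tested_momentum_equation[OF n k x] \<kappa>, of "\<mu> k" "J k (Suc n) x" "transpose (J k n x)"]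
    by (simp add: sq a norm_transpose viscous_residual_def g_def mult.assoc del: norm_scaleR)
qed

text \<open>The phases have to be summed here: both the sign of the drag work and the bound on the
  drag force rest on the symmetry in \<open>k\<close> and \<open>l\<close>.\<close>

lemma energy_step:
  assumes n: "n < N" and x: "x \<in> \<Omega>"
  shows "energy (Suc n) x + \<tau> * dissipation n x
    \<le> (1 + growth) * energy n x + 2 * \<tau> * residual n x"
proof -
  define g where "g k = (\<Sum>l=1..M. drag_coefficient k l n x *\<^sub>R (uh k n x - uh l n x))" for k
  have work: "2 * (\<Sum>k=1..M. g k \<bullet> uh k n x)
      = (\<Sum>k=1..M. \<Sum>l=1..M. (norm (sqrt (drag_coefficient k l n x) *\<^sub>R (uh k n x - uh l n x)))\<^sup>2)"
    using drag_work[of "{1..M}" "\<lambda>k l. drag_coefficient k l n x" "\<lambda>k. uh k n x"]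
      drag_coefficient[OF n _ _ x]
    by (simp add: g_def power_mult_distrib)
  let ?K = "4 * (D * (real M - 1))\<^sup>2"
  have "\<tau>\<^sup>2 / (\<rho>min * \<alpha>min) * (\<Sum>k=1..M. (norm (g k))\<^sup>2)
      \<le> \<tau>\<^sup>2 / (\<rho>min * \<alpha>min) * (?K * (\<Sum>k=1..M. (norm (uh k n x))\<^sup>2))"
    using drag_force_bound[of "{1..M}" D "\<lambda>k l. drag_coefficient k l n x" "\<lambda>k. uh k n x"]
      drag_coefficient[OF n _ _ x] D_pos rho_min_pos alpha_min_pos
    by (intro mult_left_mono) (auto simp: g_def)
  also have "\<dots> = growth * (\<Sum>k=1..M. \<rho>min * \<alpha>min * (norm (uh k n x))\<^sup>2)"
    using rho_min_pos alpha_min_pos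
    by (simp add: growth_def power_divide power_mult_distrib power2_eq_square flip: sum_distrib_left)
  also have "\<dots> \<le> growth * energy n x"
    unfolding energy_def
  proof (intro mult_left_mono sum_mono)
    fix k assume k: "k \<in> {1..M}"
    have a: "0 < \<alpha> k n x" "\<alpha>min \<le> \<alpha> k n x"
      using alpha_pos[OF k _ x] alpha_ge_min[OF k _ x] n by auto
    have "\<rho>min * \<alpha>min * (norm (uh k n x))\<^sup>2 \<le> \<rho> k * \<alpha> k n x * (norm (uh k n x))\<^sup>2"
      using a rho_min[OF k] rho_min_pos alpha_min_pos by (intro mult_right_mono mult_mono) auto
    also have "\<dots> = \<rho> k * (norm (sqrt (\<alpha> k n x) *\<^sub>R uh k n x))\<^sup>2"
      using a by (simp add: power_mult_distrib)
    also have "\<dots> \<le> \<dots> + \<tau> * \<mu> k * (norm (sqrt (\<alpha> k n x) *\<^sub>R J k n x))\<^sup>2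
        + \<tau>\<^sup>2 / \<rho> k * (norm (sqrt (\<alpha> k n x) *\<^sub>R grad (p n) x))\<^sup>2"
      using tau_pos mu_pos[OF k] rho_pos[OF k] by simp
    finally show "\<rho>min * \<alpha>min * (norm (uh k n x))\<^sup>2 \<le> \<dots>" .
  qed (simp add: growth_def)
  finally have force: "\<tau>\<^sup>2 / (\<rho>min * \<alpha>min) * (\<Sum>k=1..M. (norm (g k))\<^sup>2) \<le> growth * energy n x" .
  have "energy (Suc n) x + \<tau> * (\<Sum>k=1..M. \<mu> k * (norm (sqrt (\<alpha> k (Suc n) x) *\<^sub>R J k (Suc n) x
        + sqrt (\<alpha> k n x) *\<^sub>R transpose (J k n x)))\<^sup>2) + 2 * \<tau> * (\<Sum>k=1..M. g k \<bullet> uh k n x)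
    \<le> energy n x + \<tau>\<^sup>2 / (\<rho>min * \<alpha>min) * (\<Sum>k=1..M. (norm (g k))\<^sup>2) + 2 * \<tau> * residual n x"
    unfolding energy_def residual_def sum_distrib_left sum.distrib[symmetric] g_def
    by (intro sum_mono phase_step[OF n _ x])
  \<comment> \<open>Testing with twice the time step supplies the factor 2 that
    \<open>drag_work\<close> needs, so the full drag dissipation is recovered.\<close>
  moreover have "dissipation n x = (\<Sum>k=1..M. \<mu> k * (norm (sqrt (\<alpha> k (Suc n) x) *\<^sub>R J k (Suc n) x
        + sqrt (\<alpha> k n x) *\<^sub>R transpose (J k n x)))\<^sup>2) + 2 * (\<Sum>k=1..M. g k \<bullet> uh k n x)"
    unfolding dissipation_def work sum.distrib ..
  ultimately show ?thesis using force by (simp add: algebra_simps)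
qed

section \<open>Vanishing of the integrated residuals\<close>

lemma has_integral_convective_residual:
  assumes n: "n < N" and k: "k \<in> {1..M}"
  shows "has_bochner_integral (lebesgue_on \<Omega>) (convective_residual k n) 0"
proof -
  note reg = phase_regular[OF k, of n] phase_regular[OF k, of "Suc n"]
  have "has_bochner_integral (lebesgue_on \<Omega>) (\<lambda>x. 1 / 2 * (u k (Suc n) x
      \<bullet> row_divergence (\<lambda>y. \<chi> i. (\<alpha> k (Suc n) y * u k (Suc n) y $ i) *\<^sub>R u k n y) x
      + (\<chi> i. (\<alpha> k (Suc n) x * u k (Suc n) x $ i) *\<^sub>R u k n x) \<bullet> J k (Suc n) x)) (1 / 2 * 0)"
    using n k regular u_frontier[OF k, of "Suc n"] reg
    by (intro has_bochner_integral_mult_right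
          row_int_by_parts_residual[OF _ open_domain AE_frontier, of nrm])
      (auto simp: scheme_regular_def)
  then show ?thesis
    using n reg
    by (subst (asm) has_bochner_integral_cong[OF refl _ refl, where g = "convective_residual k n"])
      (auto simp: convective_flux_divergence convective_residual_def)
qed

lemma has_integral_viscous_residual:
  assumes n: "n < N" and k: "k \<in> {1..M}"
  shows "has_bochner_integral (lebesgue_on \<Omega>)
      (viscous_residual k n (\<lambda>x. (\<mu> k * \<alpha> k (Suc n) x) *\<^sub>R J k (Suc n) x)) 0"
    and "has_bochner_integral (lebesgue_on \<Omega>) (viscous_residual k n
      (\<lambda>x. (\<mu> k * sqrt (\<alpha> k (Suc n) x * \<alpha> k n x)) *\<^sub>R transpose (J k n x))) 0"
  using n k regular u_frontier[OF k, of "Suc n"] phase_regular[OF k, of "Suc n"]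
  unfolding viscous_residual_def
  by (intro row_int_by_parts_residual[OF _ open_domain AE_frontier, of nrm];
      simp add: scheme_regular_def)+

text \<open>The correction makes the total flux of the hatted velocities equal to
  \<open>- \<tau>\<close> times the flux balance of the pressure equation. That equation thus says
  that this flux is orthogonal to the new pressure gradient.\<close>

lemma has_integral_pressure_residual:
  assumes n: "n < N"
  shows "has_bochner_integral (lebesgue_on \<Omega>)
    (\<lambda>x. \<Sum>k=1..M. \<alpha> k (Suc n) x * (uh k (Suc n) x \<bullet> grad (p (Suc n)) x)) 0"
proof -
  let ?s' = "\<lambda>x. \<Sum>k=1..M. \<alpha> k (Suc n) x / \<rho> k"
  let ?s = "\<lambda>x. \<Sum>k=1..M. sqrt (\<alpha> k (Suc n) x * \<alpha> k n x) / \<rho> k"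
  let ?F = "\<lambda>x. \<Sum>k=1..M. \<alpha> k (Suc n) x *\<^sub>R u k (Suc n) x"
  let ?f = "\<lambda>x. (?s' x *\<^sub>R grad (p (Suc n)) x - ?s x *\<^sub>R grad (p n) x - (1 / \<tau>) *\<^sub>R ?F x)
    \<bullet> grad (p (Suc n)) x"
  have eq: "pressure_equation \<Omega> \<sigma> nrm M \<tau> \<rho> \<alpha> u p n"
    using solution n by (simp add: scheme_solution_def)
  have rho0: "\<rho> k \<noteq> 0" if "k \<in> {1..M}" for k
    using rho_pos[OF that] by simp
  have "has_bochner_integral (lebesgue_on \<Omega>) ?f 0"
  proof (rule pressure_residual[OF open_domain AE_frontier, where nrm = nrm])
    show "int_by_parts \<Omega> \<sigma> nrm (\<lambda>x. ?s' x *\<^sub>R grad (p (Suc n)) x) (p (Suc n))"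
      "int_by_parts \<Omega> \<sigma> nrm (\<lambda>x. ?s x *\<^sub>R grad (p n) x) (p (Suc n))"
      "int_by_parts \<Omega> \<sigma> nrm ?F (p (Suc n))"
      using regular n unfolding scheme_regular_def by blast+
    show "continuous_on (closure \<Omega>) ?s'" "continuous_on (closure \<Omega>) ?s"
      "continuous_on (closure \<Omega>) ?F"
      using n by (auto intro!: continuous_intros phase_regular rho0)
    show "?F x = 0" if "x \<in> frontier \<Omega>" for x
      using n that by (simp add: u_frontier)
    show "AE x in \<sigma>. has_boundary_value \<Omega> (grad (p (Suc n))) x"
      "AE x in \<sigma>. has_boundary_value \<Omega> (grad (p n)) x"
      using n by (auto intro: pressure_regular)
    show "divergence (\<lambda>y. ?s' y *\<^sub>R grad (p (Suc n)) y) x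
        = divergence (\<lambda>y. ?s y *\<^sub>R grad (p n) y) x + 1 / \<tau> * divergence ?F x" if "x \<in> \<Omega>" for x
      using eq that unfolding pressure_equation_def by blast
    show "AE x in \<sigma>. ?s' x * (nrm x \<bullet> boundary_value \<Omega> (grad (p (Suc n))) x)
        = ?s x * (nrm x \<bullet> boundary_value \<Omega> (grad (p n)) x)"
      using eq unfolding pressure_equation_def normal_derivative_def by blast
  qed
  then have "has_bochner_integral (lebesgue_on \<Omega>) (\<lambda>x. - \<tau> * ?f x) (- \<tau> * 0)"
    by (rule has_bochner_integral_mult_right)
  moreover have "(\<Sum>k=1..M. \<alpha> k (Suc n) x * (uh k (Suc n) x \<bullet> grad (p (Suc n)) x)) = - \<tau> * ?f x"
    if x: "x \<in> \<Omega>" for x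
  proof -
    let ?q = "grad (p (Suc n)) x"
    have "\<alpha> k (Suc n) x * (uh k (Suc n) x \<bullet> ?q)
        = - \<tau> * (\<alpha> k (Suc n) x / \<rho> k * (?q \<bullet> ?q)
            - sqrt (\<alpha> k (Suc n) x * \<alpha> k n x) / \<rho> k * (grad (p n) x \<bullet> ?q)
            - 1 / \<tau> * (\<alpha> k (Suc n) x * (u k (Suc n) x \<bullet> ?q)))" if k: "k \<in> {1..M}" for k
    proof -
      have a: "0 < \<alpha> k (Suc n) x" "0 < \<alpha> k n x"
        using alpha_pos[OF k _ x] n by auto
      \<comment> \<open>This identity matches the old-pressure weight of the correction with the
        geometric mean in the pressure equation.\<close>
      then have "\<alpha> k (Suc n) x * sqrt (\<alpha> k n x / \<alpha> k (Suc n) x) = sqrt (\<alpha> k (Suc n) x * \<alpha> k n x)"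
        by (simp add: real_sqrt_divide real_sqrt_mult real_div_sqrt flip: times_divide_eq_left)
      then show ?thesis
        using tau_pos rho0[OF k]
        by (simp add: velocity_correction[OF n k x] inner_add_left inner_diff_left algebra_simps)
    qed
    then have "(\<Sum>k=1..M. \<alpha> k (Suc n) x * (uh k (Suc n) x \<bullet> ?q))
        = (\<Sum>k=1..M. - \<tau> * (\<alpha> k (Suc n) x / \<rho> k * (?q \<bullet> ?q)
            - sqrt (\<alpha> k (Suc n) x * \<alpha> k n x) / \<rho> k * (grad (p n) x \<bullet> ?q)
            - 1 / \<tau> * (\<alpha> k (Suc n) x * (u k (Suc n) x \<bullet> ?q))))"
      by (intro sum.cong refl)
    then show ?thesis
      by (simp only: inner_diff_left inner_scaleR_left inner_sum_left sum_subtractf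
          sum_distrib_left[symmetric] sum_distrib_right[symmetric])
  qed
  ultimately show ?thesis
    by (subst has_bochner_integral_cong[OF refl _ refl]) auto
qed

lemma has_integral_residual:
  assumes "n < N"
  shows "has_bochner_integral (lebesgue_on \<Omega>) (residual n) 0"
proof -
  \<comment> \<open>The pressure work is split off as a sum over all phases, since the pressure
    equation controls only the total flux.\<close>
  have "has_bochner_integral (lebesgue_on \<Omega>) (\<lambda>x. (\<Sum>k=1..M.
      viscous_residual k n (\<lambda>y. (\<mu> k * \<alpha> k (Suc n) y) *\<^sub>R J k (Suc n) y) x
    + viscous_residual k n (\<lambda>y. (\<mu> k * sqrt (\<alpha> k (Suc n) y * \<alpha> k n y)) *\<^sub>R transpose (J k n y)) x
    - \<rho> k * convective_residual k n x)
    - (\<Sum>k=1..M. \<alpha> k (Suc n) x * (uh k (Suc n) x \<bullet> grad (p (Suc n)) x)))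
    ((\<Sum>k=1..M. 0 + 0 - \<rho> k * 0) - 0)"
    using assms
    by (intro has_bochner_integral_diff has_bochner_integral_sum has_bochner_integral_add
        has_bochner_integral_mult_right has_integral_viscous_residual
        has_integral_convective_residual has_integral_pressure_residual) auto
  then show ?thesis
    by (simp add: residual_def[abs_def] sum_subtractf)
qed

section \<open>Integrability of the densities and the integrated step\<close>

lemma square_integrable_sqrt_alpha:
  fixes f :: "real^'d \<Rightarrow> 'b::{real_normed_vector,second_countable_topology}"
  assumes kn: "k \<in> {1..M}" "n \<le> N" and f: "square_integrable \<Omega> f"
  shows "square_integrable \<Omega> (\<lambda>x. sqrt (\<alpha> k n x) *\<^sub>R f x)"
proof -
  have c: "continuous_on (closure \<Omega>) (\<lambda>x. sqrt (\<alpha> k n x))"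
    using phase_regular(1)[OF kn] by (intro continuous_intros)
  obtain K where "\<And>x. x \<in> \<Omega> \<Longrightarrow> norm (sqrt (\<alpha> k n x)) \<le> K"
    using continuous_on_closure_imp_bounded[OF bounded_domain c] by blast
  then show ?thesis
    by (intro square_integrable_scaleR[OF f]
        continuous_on_closure_imp_measurable[OF open_domain c]) auto
qed

text \<open>No induction over time is involved: the correction expresses a later hatted velocity
  through the velocity and two pressure gradients, all square integrable by regularity.\<close>

lemma square_integrable_uh:
  assumes k: "k \<in> {1..M}" and "n \<le> N"
  shows "square_integrable \<Omega> (uh k n)"
proof (cases n)
  case 0
  have "square_integrable \<Omega> (u k 0)"
    using phase_regular(3)[OF k, of 0]
    by (intro square_integrable_continuous open_domain bounded_domain) auto
  then show ?thesis unfolding 0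
    by (rule square_integrable_cong) (simp add: uh_0[OF k])
next
  case (Suc m)
  then have m: "m < N" "m \<le> N" "Suc m \<le> N" using assms(2) by auto
  have meas: "\<alpha> k m \<in> borel_measurable (lebesgue_on \<Omega>)"
    "\<alpha> k (Suc m) \<in> borel_measurable (lebesgue_on \<Omega>)"
    using m by (auto intro!: continuous_on_closure_imp_measurable open_domain phase_regular k)
  obtain K where K: "\<And>x. x \<in> \<Omega> \<Longrightarrow> norm (\<alpha> k m x) \<le> K"
    using continuous_on_closure_imp_bounded[OF bounded_domain phase_regular(1)[OF k m(2)]] by blast
  \<comment> \<open>The old fraction is bounded by continuity on the compact closure, the new one
    from below by \<open>\<alpha>min\<close>.\<close>
  have bound: "\<bar>sqrt (\<alpha> k m x / \<alpha> k (Suc m) x)\<bar> \<le> sqrt (K / \<alpha>min)" if x: "x \<in> \<Omega>" for x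
    using K[OF x] alpha_ge_min[OF k m(3) x] alpha_pos[OF k m(2) x] alpha_min_pos
    by (simp add: frac_le)
  have "square_integrable \<Omega> (\<lambda>x. u k (Suc m) x
      + (\<tau> / \<rho> k) *\<^sub>R (sqrt (\<alpha> k m x / \<alpha> k (Suc m) x) *\<^sub>R grad (p m) x - grad (p (Suc m)) x))"
    using m bound meas
    by (intro square_integrable_add square_integrable_diff square_integrable_continuous
        open_domain bounded_domain phase_regular k pressure_regular
        square_integrable_scaleR[where c = "\<lambda>_. \<tau> / \<rho> k", OF _ _ order_refl]
        square_integrable_scaleR[where c = "\<lambda>x. sqrt (\<alpha> k m x / \<alpha> k (Suc m) x)"]) auto
  then show ?thesis unfolding Suc
    by (rule square_integrable_cong) (simp add: velocity_correction[OF m(1) k])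
qed

lemma square_integrable_drag:
  assumes n: "n < N" and k: "k \<in> {1..M}" and l: "l \<in> {1..M}"
  shows "square_integrable \<Omega> (\<lambda>x. sqrt (drag_coefficient k l n x) *\<^sub>R (uh k n x - uh l n x))"
proof (rule square_integrable_scaleR)
  show "square_integrable \<Omega> (\<lambda>x. uh k n x - uh l n x)"
    using n by (intro square_integrable_diff square_integrable_uh k l) auto
  have "\<gamma> k l n \<in> borel_measurable (lebesgue_on \<Omega>)"
    using drag n k l by (simp add: admissible_drag_def)
  then show "(\<lambda>x. sqrt (drag_coefficient k l n x)) \<in> borel_measurable (lebesgue_on \<Omega>)"
    unfolding truncated_drag_def by measurable
  \<comment> \<open>The truncation provides this bound even where \<open>\<gamma>\<close> is
    unbounded.\<close>
  show "\<bar>sqrt (drag_coefficient k l n x)\<bar> \<le> sqrt D" if "x \<in> \<Omega>" for x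
    using drag_coefficient(1,2)[OF n k l that] by simp
qed

lemma integrable_norm_power2: "square_integrable \<Omega> f \<Longrightarrow> integrable (lebesgue_on \<Omega>) (\<lambda>x. (norm (f x))\<^sup>2)"
  by (simp add: square_integrable_def)

lemma square_integrable_energy:
  assumes "k \<in> {1..M}" "n \<le> N"
  shows "square_integrable \<Omega> (\<lambda>x. sqrt (\<alpha> k n x) *\<^sub>R uh k n x)"
    "square_integrable \<Omega> (\<lambda>x. sqrt (\<alpha> k n x) *\<^sub>R J k n x)"
    "square_integrable \<Omega> (\<lambda>x. sqrt (\<alpha> k n x) *\<^sub>R grad (p n) x)"
  using assms
  by (auto intro!: square_integrable_sqrt_alpha square_integrable_uh phase_regular pressure_regular)

lemma square_integrable_viscous_dissipation:
  assumes "k \<in> {1..M}" "n < N"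
  shows "square_integrable \<Omega> (\<lambda>x. sqrt (\<alpha> k (Suc n) x) *\<^sub>R J k (Suc n) x
    + sqrt (\<alpha> k n x) *\<^sub>R transpose (J k n x))"
  using assms
  by (intro square_integrable_add square_integrable_sqrt_alpha square_integrable_transpose
      phase_regular) auto

lemma has_integral_energy:
  assumes "n \<le> N"
  shows "has_bochner_integral (lebesgue_on \<Omega>) (energy n) (\<Sum>k=1..M.
      \<rho> k * (L2norm \<Omega> (\<lambda>x. sqrt (\<alpha> k n x) *\<^sub>R uh k n x))\<^sup>2
    + \<tau> * \<mu> k * (L2norm \<Omega> (\<lambda>x. sqrt (\<alpha> k n x) *\<^sub>R J k n x))\<^sup>2
    + \<tau>\<^sup>2 / \<rho> k * (L2norm \<Omega> (\<lambda>x. sqrt (\<alpha> k n x) *\<^sub>R grad (p n) x))\<^sup>2)"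
  unfolding energy_def[abs_def] L2norm_power2 using assms
  by (intro has_bochner_integral_sum has_bochner_integral_add has_bochner_integral_mult_right
      has_bochner_integral_integrable integrable_norm_power2 square_integrable_energy)

lemma has_integral_dissipation:
  assumes "n < N"
  shows "has_bochner_integral (lebesgue_on \<Omega>) (dissipation n) (\<Sum>k=1..M.
      \<mu> k * (L2norm \<Omega> (\<lambda>x. sqrt (\<alpha> k (Suc n) x) *\<^sub>R J k (Suc n) x
                       + sqrt (\<alpha> k n x) *\<^sub>R transpose (J k n x)))\<^sup>2
    + (\<Sum>l=1..M. (L2norm \<Omega> (\<lambda>x. sqrt (drag_coefficient k l n x) *\<^sub>R (uh k n x - uh l n x)))\<^sup>2))"
  unfolding dissipation_def[abs_def] L2norm_power2 using assms
  by (intro has_bochner_integral_sum has_bochner_integral_add has_bochner_integral_mult_right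
      has_bochner_integral_integrable integrable_norm_power2 square_integrable_drag
      square_integrable_viscous_dissipation)

lemma integral_energy_step:
  assumes n: "n < N"
  shows "integral\<^sup>L (lebesgue_on \<Omega>) (energy (Suc n)) + \<tau> * integral\<^sup>L (lebesgue_on \<Omega>) (dissipation n)
    \<le> (1 + growth) * integral\<^sup>L (lebesgue_on \<Omega>) (energy n)"
proof -
  note E = has_integral_energy[of n] has_integral_energy[of "Suc n"]
    has_integral_dissipation[OF n] has_integral_residual[OF n]
  have "has_bochner_integral (lebesgue_on \<Omega>) (\<lambda>x. energy (Suc n) x + \<tau> * dissipation n x)
      (integral\<^sup>L (lebesgue_on \<Omega>) (energy (Suc n)) + \<tau> * integral\<^sup>L (lebesgue_on \<Omega>) (dissipation n))"
    using E n by (intro has_bochner_integral_add has_bochner_integral_mult_right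
        has_bochner_integral_integrable) (auto simp: has_bochner_integral_iff)
  moreover have "has_bochner_integral (lebesgue_on \<Omega>)
      (\<lambda>x. (1 + growth) * energy n x + 2 * \<tau> * residual n x)
      ((1 + growth) * integral\<^sup>L (lebesgue_on \<Omega>) (energy n) + 2 * \<tau> * 0)"
    using E n by (intro has_bochner_integral_add has_bochner_integral_mult_right
        has_bochner_integral_integrable) (auto simp: has_bochner_integral_iff)
  ultimately show ?thesis
    using integral_mono[of "lebesgue_on \<Omega>" "\<lambda>x. energy (Suc n) x + \<tau> * dissipation n x"
        "\<lambda>x. (1 + growth) * energy n x + 2 * \<tau> * residual n x"] energy_step[OF n]
    by (simp add: has_bochner_integral_iff)
qed

end

section \<open>Discrete Gronwall inequality and conclusion\<close>

lemma discrete_gronwall: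
  fixes E d :: "nat \<Rightarrow> real"
  assumes step: "\<And>n. n < N \<Longrightarrow> E (Suc n) + d n \<le> (1 + c) * E n"
    and d: "\<And>n. n < N \<Longrightarrow> 0 \<le> d n" and c: "0 \<le> c" and E0: "0 \<le> E 0"
  shows "E N + (\<Sum>n<N. d n) \<le> E 0 * exp (c * real N)"
proof -
  have "E m + (\<Sum>n<m. d n) \<le> (1 + c) ^ m * E 0" if "m \<le> N" for m
    using that
  proof (induction m)
    case (Suc m)
    have "E (Suc m) + (\<Sum>n<Suc m. d n) \<le> (1 + c) * E m + 1 * (\<Sum>n<m. d n)"
      using step[of m] Suc.prems by simp
    \<comment> \<open>The accumulated dissipation is also enlarged by \<open>1 + c\<close>, so that
      the induction hypothesis applies to the whole bracket.\<close>
    also have "\<dots> \<le> (1 + c) * E m + (1 + c) * (\<Sum>n<m. d n)"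
      using c d Suc.prems by (intro add_left_mono mult_right_mono sum_nonneg) auto
    also have "\<dots> \<le> (1 + c) * ((1 + c) ^ m * E 0)"
      using Suc c by (simp flip: distrib_left)
    finally show ?case by simp
  qed simp
  then have "E N + (\<Sum>n<N. d n) \<le> (1 + c) ^ N * E 0" by simp
  also have "\<dots> \<le> exp c ^ N * E 0"
    using c E0 exp_ge_add_one_self[of c] by (intro mult_right_mono power_mono) auto
  also have "\<dots> = E 0 * exp (c * real N)"
    by (simp add: exp_of_nat2_mult)
  finally show ?thesis .
qed

theorem theorem6p3:
  fixes \<Omega> :: "(real^'d) set" and \<sigma> :: "(real^'d) measure" and nrm :: "real^'d \<Rightarrow> real^'d"
    and M N :: nat and T \<tau> D \<alpha>min \<rho>min :: real
    and \<rho> \<nu> \<mu> B :: "nat \<Rightarrow> real"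
    and \<gamma> :: "nat \<Rightarrow> nat \<Rightarrow> nat \<Rightarrow> real^'d \<Rightarrow> real"
    and \<alpha> :: "nat \<Rightarrow> nat \<Rightarrow> real^'d \<Rightarrow> real"
    and u uh :: "nat \<Rightarrow> nat \<Rightarrow> real^'d \<Rightarrow> real^'d"
    and p :: "nat \<Rightarrow> real^'d \<Rightarrow> real"
  assumes dim: "CARD('d) = 2 \<or> CARD('d) = 3"
    and domain: "gauss_domain \<Omega> \<sigma> nrm"
    and M: "M \<ge> 2" and T: "T > 0" and N: "N \<ge> 1" and tau: "\<tau> = T / real N" and D: "D > 0"
    and parameters: "\<And>k. k \<in> {1..M} \<Longrightarrow> \<rho> k > 0 \<and> \<nu> k > 0 \<and> \<mu> k = \<rho> k * \<nu> k"
    and drag: "admissible_drag \<Omega> M N \<gamma>"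
    and regular: "scheme_regular \<Omega> \<sigma> nrm M N \<rho> \<mu> \<alpha> u p"
    and solution: "scheme_solution \<Omega> \<sigma> nrm M N \<tau> \<rho> \<mu> D \<gamma> \<alpha> u uh p"
    and alpha_min: "\<alpha>min > 0"
      "\<And>k n. k \<in> {1..M} \<Longrightarrow> n \<le> N \<Longrightarrow> AE x in lebesgue_on \<Omega>. \<alpha> k n x \<ge> \<alpha>min"
    and rho_min: "\<rho>min = Min (\<rho> ` {1..M})"
    and B: "\<And>k. k \<in> {1..M} \<Longrightarrow> B k =
        (1 + (2 * D * (real M - 1) * \<tau> / (\<rho>min * \<alpha>min))\<^sup>2)
            * \<rho> k * (L2norm \<Omega> (\<lambda>x. sqrt (\<alpha> k 0 x) *\<^sub>R u k 0 x))\<^sup>2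
        + \<tau> * \<mu> k * (L2norm \<Omega> (\<lambda>x. sqrt (\<alpha> k 0 x) *\<^sub>R jacobian (u k 0) (at x)))\<^sup>2
        + \<tau>\<^sup>2 / \<rho> k * (L2norm \<Omega> (\<lambda>x. sqrt (\<alpha> k 0 x) *\<^sub>R grad (p 0) x))\<^sup>2"
  shows "(\<Sum>k=1..M.
            \<rho> k * (L2norm \<Omega> (\<lambda>x. sqrt (\<alpha> k N x) *\<^sub>R uh k N x))\<^sup>2
          + \<tau> * \<mu> k * (L2norm \<Omega> (\<lambda>x. sqrt (\<alpha> k N x) *\<^sub>R jacobian (u k N) (at x)))\<^sup>2
          + \<tau>\<^sup>2 / \<rho> k * (L2norm \<Omega> (\<lambda>x. sqrt (\<alpha> k N x) *\<^sub>R grad (p N) x))\<^sup>2)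
       + \<tau> * (\<Sum>n=1..N. \<Sum>k=1..M.
            \<mu> k * (L2norm \<Omega> (\<lambda>x. sqrt (\<alpha> k n x) *\<^sub>R jacobian (u k n) (at x)
                       + sqrt (\<alpha> k (n - 1) x) *\<^sub>R transpose (jacobian (u k (n - 1)) (at x))))\<^sup>2
          + (\<Sum>l=1..M. (L2norm \<Omega> (\<lambda>x. sqrt (truncated_drag D (\<gamma> k l (n - 1)) x)
                                       *\<^sub>R (uh k (n - 1) x - uh l (n - 1) x)))\<^sup>2))
       \<le> (\<Sum>k=1..M. B k) * exp (4 * (D * (real M - 1) / (\<rho>min * \<alpha>min))\<^sup>2 * T * \<tau>)"
proof -
  have rho_pos: "\<rho> k > 0" if "k \<in> {1..M}" for k
    using parameters that by blast
  have tau_pos: "\<tau> > 0" using T N tau by simp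
  interpret fractional_step \<Omega> \<sigma> nrm M N \<tau> D \<alpha>min \<rho>min \<rho> \<mu> \<gamma> \<alpha> u uh p
  proof
    \<comment> \<open>The minimum is attained, as there is at least one phase, and so inherits
      positivity.\<close>
    have "\<rho>min \<in> \<rho> ` {1..M}"
      unfolding rho_min using M by (intro Min_in) auto
    then show "\<rho>min > 0" using rho_pos by auto
    show "\<rho>min \<le> \<rho> k" if "k \<in> {1..M}" for k
      unfolding rho_min using that by (intro Min_le) auto
    show "\<mu> k > 0" if "k \<in> {1..M}" for k
      using parameters[OF that] by simp
  qed (use domain tau_pos D rho_pos drag regular solution alpha_min in auto)
  define E where "E n = integral\<^sup>L (lebesgue_on \<Omega>) (energy n)" for n
  define S where "S n = integral\<^sup>L (lebesgue_on \<Omega>) (dissipation n)" for n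
  note E_eq = has_bochner_integral_integral_eq[OF has_integral_energy, folded E_def]
  note S_eq = has_bochner_integral_integral_eq[OF has_integral_dissipation, folded S_def]
  have E0: "0 \<le> E 0"
    unfolding E_eq[OF le0] using tau_pos rho_pos mu_pos
    by (intro sum_nonneg add_nonneg_nonneg mult_nonneg_nonneg divide_nonneg_nonneg)
      (auto simp: less_imp_le)
  have S_nonneg: "0 \<le> S n" if "n < N" for n
    unfolding S_eq[OF that] using mu_pos
    by (intro sum_nonneg add_nonneg_nonneg mult_nonneg_nonneg) (auto simp: less_imp_le)
  \<comment> \<open>The growth per step is quadratic in \<open>\<tau>\<close>; over \<open>N\<close>
    steps one factor becomes \<open>N * \<tau> = T\<close> and the other remains in the
    exponent.\<close>
  have growth_N: "growth * real N = 4 * (D * (real M - 1) / (\<rho>min * \<alpha>min))\<^sup>2 * T * \<tau>"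
    unfolding growth_def using N by (simp add: tau power2_eq_square mult_ac)
  have "E N + (\<Sum>n<N. \<tau> * S n) \<le> E 0 * exp (growth * real N)"
  proof (rule discrete_gronwall)
    show "E (Suc n) + \<tau> * S n \<le> (1 + growth) * E n" if "n < N" for n
      using integral_energy_step[OF that] by (simp add: E_def S_def)
    show "0 \<le> \<tau> * S n" if "n < N" for n
      using S_nonneg[OF that] tau_pos by simp
  qed (simp_all add: E0 growth_def)
  also have "E 0 \<le> (\<Sum>k=1..M. B k)"
    unfolding E_eq[OF le0]
  proof (rule sum_mono)
    fix k assume k: "k \<in> {1..M}"
    let ?c = "2 * D * (real M - 1) * \<tau> / (\<rho>min * \<alpha>min)"
    have "L2norm \<Omega> (\<lambda>x. sqrt (\<alpha> k 0 x) *\<^sub>R uh k 0 x) = L2norm \<Omega> (\<lambda>x. sqrt (\<alpha> k 0 x) *\<^sub>R u k 0 x)"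
      unfolding L2norm_def using uh_0[OF k]
      by (intro arg_cong[where f = sqrt] Bochner_Integration.integral_cong) auto
    \<comment> \<open>Initially the hatted velocity is the velocity itself, and \<open>B k\<close>
      weights its kinetic energy by a factor at least 1.\<close>
    moreover have "\<rho> k * X \<le> (1 + ?c\<^sup>2) * \<rho> k * X" if "0 \<le> X" for X
      using mult_right_mono[of 1 "1 + ?c\<^sup>2" "\<rho> k * X"] that rho_pos[OF k] by (simp add: mult.assoc)
    ultimately show "\<rho> k * (L2norm \<Omega> (\<lambda>x. sqrt (\<alpha> k 0 x) *\<^sub>R uh k 0 x))\<^sup>2
        + \<tau> * \<mu> k * (L2norm \<Omega> (\<lambda>x. sqrt (\<alpha> k 0 x) *\<^sub>R jacobian (u k 0) (at x)))\<^sup>2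
        + \<tau>\<^sup>2 / \<rho> k * (L2norm \<Omega> (\<lambda>x. sqrt (\<alpha> k 0 x) *\<^sub>R grad (p 0) x))\<^sup>2 \<le> B k"
      unfolding B[OF k] by (intro add_right_mono) simp
  qed
  finally have "E N + \<tau> * (\<Sum>n<N. S n) \<le> (\<Sum>k=1..M. B k) * exp (growth * real N)"
    by (simp add: sum_distrib_left mult_right_mono)
  moreover have "(\<Sum>n<N. S n) = (\<Sum>n=1..N. \<Sum>k=1..M.
            \<mu> k * (L2norm \<Omega> (\<lambda>x. sqrt (\<alpha> k n x) *\<^sub>R jacobian (u k n) (at x)
                       + sqrt (\<alpha> k (n - 1) x) *\<^sub>R transpose (jacobian (u k (n - 1)) (at x))))\<^sup>2
          + (\<Sum>l=1..M. (L2norm \<Omega> (\<lambda>x. sqrt (truncated_drag D (\<gamma> k l (n - 1)) x)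
                                       *\<^sub>R (uh k (n - 1) x - uh l (n - 1) x)))\<^sup>2))"
    \<comment> \<open>Step \<open>n\<close> of the recursion is the summand at its new level
      \<open>Suc n\<close>.\<close>
    by (rule sum.reindex_bij_witness[of _ "\<lambda>n. n - 1" Suc]) (auto simp: S_eq)
  ultimately show ?thesis
    unfolding growth_N E_eq[OF order_refl] by simp
qed

end
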